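(* For every integer $n\ge 3$, a random walk on the $n$-gonal prism graph $\mathcal{P}_n$ produces a finite hermitian (hence commutative) discrete hypergroup: for every vertex $v_0$ of $\mathcal{P}_n$, $\mathcal{R}(\mathcal{P}_n)$ with the convolution $\circ_{v_0}$ and the conjugate-linear map $*$ fixing every element of $\mathcal{R}(\mathcal{P}_n)$ is a hermitian discrete hypergroup, and its structure is independent of the choice of $v_0$. In particular, finite commutative hypergroups of arbitrarily large order arise in this way.
   Context: **Prism graph.** $\mathcal{P}_n$ is the graph formed by the vertices and edges of the $n$-gonal prism; equivalently, it has vertex set $\mathbb{Z}/n\mathbb{Z}\oplus\mathbb{Z}/2\mathbb{Z}$ and two vertices are adjacent if and only if their difference lies in $\{(\overline{1},\overline{0}),(\overline{-1},\overline{0}),(\overline{0},\overline{1})\}$. **Discrete hypergroup.** For a set $K$, let $\mathbb{C}K$ be the free complex vector space on $K$; for $\mu\in\mathbb{C}K$ let $\mu(x)$ be the coefficient of $x\in K$, $\|\mu\|_1=\sum_{x}|\mu(x)|$, $\mathrm{supp}(\mu)=\{x\in K: \mu(x)\ne 0\}$. $K$, with a bilinear convolution $\circ$ on $\mathbb{C}K$ and a map $*:\mathbb{C}K\to\mathbb{C}K$, is a discrete hypergroup if: (i) $(\mathbb{C}K,\circ,* )$ is an associative $*$-algebra ($*$ is conjugate-linear, involutive and anti-multiplicative) with a neutral element $e\in K$; (ii) for all $x,y,z\in K$, $(x\circ y)(z)\ge 0$ is real, and $\|x\circ y\|_1=1$; (iii) $*$ maps $K$ onto $K$; (iv) for $x,y\in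 K$, $e\in\mathrm{supp}(x\circ y)$ if and only if $y=x^*$. It is hermitian if $*$ restricted to $K$ is the identity, commutative if $\circ$ is commutative, and its order is $|K|$. **Construction from a graph.** For a connected simple graph $X=(V,E)$ with all vertices of finite degree, $d$ is the graph distance, $\mathrm{diam}(X)\in\mathbb{N}_0\cup\{\infty\}$ the supremum of distances, $\Gamma_i(v)=\{w\in V: d(v,w)=i\}$, $I=\{i\in\mathbb{N}_0: i\le \mathrm{diam}(X)\}$, $R_i=\{(v,w)\in V\times V: d(v,w)=i\}$, $\mathcal{R}(X)=\{R_i\}_{i\in I}$. For $v_0\in V$ put $$P_{i,j}^k=\frac{1}{|\Gamma_i(v_0)|}\sum_{v\in\Gamma_i(v_0)}\frac{|\Gamma_j(v)\cap\Gamma_k(v_0)|}{|\Gamma_j(v)|}\qquad(i,j,k\in I),$$ provided no denominator vanishes, and define the bilinear convolution $\circ_{v_0}$ on $\mathbb{C}\mathcal{R}(X)$ by $R_i\circ_{v_0}R_j=\sum_{k\in I}P_{i,j}^kR_k$. *)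

theory Defs
  imports
    Complex_Main
    "HOL-Library.Poly_Mapping"
    "HOL-Library.Extended_Nat"
    "HOL-Algebra.Elementary_Groups"
begin

section \<open>Discrete hypergroups\<close>

text \<open>
  The free complex vector space on a set \<open>K\<close> consists of the finitely supported functions
  \<open>'k \<Rightarrow>\<^sub>0 complex\<close> whose support lies in \<open>K\<close>; an element \<open>x\<close> of \<open>K\<close> is identified with \<open>pt x\<close>.
  The ring multiplication that \<open>Poly_Mapping\<close> provides on this type plays no role.
\<close>

definition free_space :: "'k set \<Rightarrow> ('k \<Rightarrow>\<^sub>0 complex) set" where
  "free_space K = {\<mu>. Poly_Mapping.keys \<mu> \<subseteq> K}"

definition pt :: "'k \<Rightarrow> ('k \<Rightarrow>\<^sub>0 complex)" where
  "pt x = Poly_Mapping.single x 1"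

definition cscale :: "complex \<Rightarrow> ('k \<Rightarrow>\<^sub>0 complex) \<Rightarrow> ('k \<Rightarrow>\<^sub>0 complex)" where
  "cscale c \<mu> = Poly_Mapping.map (\<lambda>a. c * a) \<mu>"

definition norm1 :: "('k \<Rightarrow>\<^sub>0 complex) \<Rightarrow> real" where
  "norm1 \<mu> = (\<Sum>x\<in>Poly_Mapping.keys \<mu>. cmod (Poly_Mapping.lookup \<mu> x))"

definition bilinear_on ::
    "'k set \<Rightarrow> (('k \<Rightarrow>\<^sub>0 complex) \<Rightarrow> ('k \<Rightarrow>\<^sub>0 complex) \<Rightarrow> ('k \<Rightarrow>\<^sub>0 complex)) \<Rightarrow> bool" where
  "bilinear_on K cv \<longleftrightarrow>
     (\<forall>\<mu>\<in>free_space K. \<forall>\<nu>\<in>free_space K. cv \<mu> \<nu> \<in> free_space K) \<and>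
     (\<forall>\<mu>\<in>free_space K. \<forall>\<mu>'\<in>free_space K. \<forall>\<nu>\<in>free_space K.
        cv (\<mu> + \<mu>') \<nu> = cv \<mu> \<nu> + cv \<mu>' \<nu> \<and> cv \<nu> (\<mu> + \<mu>') = cv \<nu> \<mu> + cv \<nu> \<mu>') \<and>
     (\<forall>c. \<forall>\<mu>\<in>free_space K. \<forall>\<nu>\<in>free_space K.
        cv (cscale c \<mu>) \<nu> = cscale c (cv \<mu> \<nu>) \<and> cv \<mu> (cscale c \<nu>) = cscale c (cv \<mu> \<nu>))"

definition conjugate_linear_on ::
    "'k set \<Rightarrow> (('k \<Rightarrow>\<^sub>0 complex) \<Rightarrow> ('k \<Rightarrow>\<^sub>0 complex)) \<Rightarrow> bool" where
  "conjugate_linear_on K st \<longleftrightarrow>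
     (\<forall>\<mu>\<in>free_space K. st \<mu> \<in> free_space K) \<and>
     (\<forall>\<mu>\<in>free_space K. \<forall>\<nu>\<in>free_space K. st (\<mu> + \<nu>) = st \<mu> + st \<nu>) \<and>
     (\<forall>c. \<forall>\<mu>\<in>free_space K. st (cscale c \<mu>) = cscale (cnj c) (st \<mu>))"

definition star_algebra_on ::
    "'k set \<Rightarrow> (('k \<Rightarrow>\<^sub>0 complex) \<Rightarrow> ('k \<Rightarrow>\<^sub>0 complex) \<Rightarrow> ('k \<Rightarrow>\<^sub>0 complex)) \<Rightarrow>
     (('k \<Rightarrow>\<^sub>0 complex) \<Rightarrow> ('k \<Rightarrow>\<^sub>0 complex)) \<Rightarrow> bool" where
  "star_algebra_on K cv st \<longleftrightarrow>
     bilinear_on K cv \<and>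
     (\<forall>\<mu>\<in>free_space K. \<forall>\<nu>\<in>free_space K. \<forall>\<rho>\<in>free_space K. cv (cv \<mu> \<nu>) \<rho> = cv \<mu> (cv \<nu> \<rho>)) \<and>
     conjugate_linear_on K st \<and>
     (\<forall>\<mu>\<in>free_space K. st (st \<mu>) = \<mu>) \<and>
     (\<forall>\<mu>\<in>free_space K. \<forall>\<nu>\<in>free_space K. st (cv \<mu> \<nu>) = cv (st \<nu>) (st \<mu>))"

definition neutral_in ::
    "'k set \<Rightarrow> (('k \<Rightarrow>\<^sub>0 complex) \<Rightarrow> ('k \<Rightarrow>\<^sub>0 complex) \<Rightarrow> ('k \<Rightarrow>\<^sub>0 complex)) \<Rightarrow> 'k \<Rightarrow> bool" where
  "neutral_in K cv e \<longleftrightarrow>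
     e \<in> K \<and> (\<forall>\<mu>\<in>free_space K. cv (pt e) \<mu> = \<mu> \<and> cv \<mu> (pt e) = \<mu>)"

definition discrete_hypergroup ::
    "'k set \<Rightarrow> (('k \<Rightarrow>\<^sub>0 complex) \<Rightarrow> ('k \<Rightarrow>\<^sub>0 complex) \<Rightarrow> ('k \<Rightarrow>\<^sub>0 complex)) \<Rightarrow>
     (('k \<Rightarrow>\<^sub>0 complex) \<Rightarrow> ('k \<Rightarrow>\<^sub>0 complex)) \<Rightarrow> bool" where
  "discrete_hypergroup K cv st \<longleftrightarrow>
     star_algebra_on K cv st \<and>
     (\<forall>x\<in>K. \<forall>y\<in>K.
        (\<forall>z\<in>K. Poly_Mapping.lookup (cv (pt x) (pt y)) z \<in> \<real> \<and>
               Re (Poly_Mapping.lookup (cv (pt x) (pt y)) z) \<ge> 0) \<and>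
        norm1 (cv (pt x) (pt y)) = 1) \<and>
     st ` (pt ` K) = pt ` K \<and>
     (\<exists>e. neutral_in K cv e \<and>
        (\<forall>x\<in>K. \<forall>y\<in>K. e \<in> Poly_Mapping.keys (cv (pt x) (pt y)) \<longleftrightarrow> pt y = st (pt x)))"

definition hermitian_hypergroup ::
    "'k set \<Rightarrow> (('k \<Rightarrow>\<^sub>0 complex) \<Rightarrow> ('k \<Rightarrow>\<^sub>0 complex) \<Rightarrow> ('k \<Rightarrow>\<^sub>0 complex)) \<Rightarrow>
     (('k \<Rightarrow>\<^sub>0 complex) \<Rightarrow> ('k \<Rightarrow>\<^sub>0 complex)) \<Rightarrow> bool" where
  "hermitian_hypergroup K cv st \<longleftrightarrow>
     discrete_hypergroup K cv st \<and> (\<forall>x\<in>K. st (pt x) = pt x)"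

definition commutative_hypergroup ::
    "'k set \<Rightarrow> (('k \<Rightarrow>\<^sub>0 complex) \<Rightarrow> ('k \<Rightarrow>\<^sub>0 complex) \<Rightarrow> ('k \<Rightarrow>\<^sub>0 complex)) \<Rightarrow>
     (('k \<Rightarrow>\<^sub>0 complex) \<Rightarrow> ('k \<Rightarrow>\<^sub>0 complex)) \<Rightarrow> bool" where
  "commutative_hypergroup K cv st \<longleftrightarrow>
     discrete_hypergroup K cv st \<and>
     (\<forall>\<mu>\<in>free_space K. \<forall>\<nu>\<in>free_space K. cv \<mu> \<nu> = cv \<nu> \<mu>)"

text \<open>The conjugate-linear map fixing every element of the basis.\<close>

definition conj_star :: "('k \<Rightarrow>\<^sub>0 complex) \<Rightarrow> ('k \<Rightarrow>\<^sub>0 complex)" where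
  "conj_star \<mu> = Poly_Mapping.map cnj \<mu>"


section \<open>Graphs and their distance relations\<close>

record 'v sgraph =
  vertices :: "'v set"
  adj :: "('v \<times> 'v) set"

definition simple_graph :: "'v sgraph \<Rightarrow> bool" where
  "simple_graph X \<longleftrightarrow>
     adj X \<subseteq> vertices X \<times> vertices X \<and> sym (adj X) \<and> irrefl (adj X)"

definition connected_graph :: "'v sgraph \<Rightarrow> bool" where
  "connected_graph X \<longleftrightarrow>
     vertices X \<noteq> {} \<and> (\<forall>v\<in>vertices X. \<forall>w\<in>vertices X. (v, w) \<in> (adj X)\<^sup>*)"

definition locally_finite_graph :: "'v sgraph \<Rightarrow> bool" where
  "locally_finite_graph X \<longleftrightarrow> (\<forall>v\<in>vertices X. finite {w. (v, w) \<in> adj X})"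

text \<open>\<open>(v, w) \<in> adj X ^^ m\<close> says that there is a walk of length \<open>m\<close> from \<open>v\<close> to \<open>w\<close>. The
  distance is meaningful only if there is some walk, in particular in connected graphs.\<close>

definition gdist :: "'v sgraph \<Rightarrow> 'v \<Rightarrow> 'v \<Rightarrow> nat" where
  "gdist X v w = (LEAST m. (v, w) \<in> adj X ^^ m)"

definition gdiam :: "'v sgraph \<Rightarrow> enat" where
  "gdiam X = (SUP v\<in>vertices X. SUP w\<in>vertices X. enat (gdist X v w))"

definition gsphere :: "'v sgraph \<Rightarrow> nat \<Rightarrow> 'v \<Rightarrow> 'v set" where
  "gsphere X i v = {w \<in> vertices X. gdist X v w = i}"

definition dist_indices :: "'v sgraph \<Rightarrow> nat set" where
  "dist_indices X = {i. enat i \<le> gdiam X}"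

definition dist_rel :: "'v sgraph \<Rightarrow> nat \<Rightarrow> ('v \<times> 'v) set" where
  "dist_rel X i = {(v, w) \<in> vertices X \<times> vertices X. gdist X v w = i}"

definition dist_rels :: "'v sgraph \<Rightarrow> ('v \<times> 'v) set set" where
  "dist_rels X = dist_rel X ` dist_indices X"


section \<open>The convolution given by a random walk\<close>

definition walk_coeff :: "'v sgraph \<Rightarrow> 'v \<Rightarrow> nat \<Rightarrow> nat \<Rightarrow> nat \<Rightarrow> real" where
  "walk_coeff X v\<^sub>0 i j k =
     1 / real (card (gsphere X i v\<^sub>0)) *
     (\<Sum>v\<in>gsphere X i v\<^sub>0.
        real (card (gsphere X j v \<inter> gsphere X k v\<^sub>0)) / real (card (gsphere X j v)))"

text \<open>No denominator vanishes in the definition of \<^const>\<open>walk_coeff\<close>.\<close>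

definition walk_coeff_defined :: "'v sgraph \<Rightarrow> 'v \<Rightarrow> bool" where
  "walk_coeff_defined X v\<^sub>0 \<longleftrightarrow>
     (\<forall>i\<in>dist_indices X. card (gsphere X i v\<^sub>0) \<noteq> 0 \<and>
        (\<forall>j\<in>dist_indices X. \<forall>v\<in>gsphere X i v\<^sub>0. card (gsphere X j v) \<noteq> 0))"

text \<open>
  The value of the convolution on a pair of basis elements. The restriction to nonzero
  coefficients makes the index set finite also if the diameter is infinite, since in a connected
  graph \<open>walk_coeff X v\<^sub>0 i j k = 0\<close> for \<open>k > i + j\<close>.
\<close>

definition walk_conv_basis :: "'v sgraph \<Rightarrow> 'v \<Rightarrow> nat \<Rightarrow> nat \<Rightarrow> (('v \<times> 'v) set \<Rightarrow>\<^sub>0 complex)" where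
  "walk_conv_basis X v\<^sub>0 i j =
     (\<Sum>k\<in>{k \<in> dist_indices X. walk_coeff X v\<^sub>0 i j k \<noteq> 0}.
        cscale (complex_of_real (walk_coeff X v\<^sub>0 i j k)) (pt (dist_rel X k)))"

text \<open>
  Its bilinear extension. For a connected graph \<open>dist_rel X\<close> is injective on \<open>dist_indices X\<close>, so
  the basis elements of the support and their indices determine each other.
\<close>

definition walk_conv ::
    "'v sgraph \<Rightarrow> 'v \<Rightarrow> (('v \<times> 'v) set \<Rightarrow>\<^sub>0 complex) \<Rightarrow> (('v \<times> 'v) set \<Rightarrow>\<^sub>0 complex) \<Rightarrow>
     (('v \<times> 'v) set \<Rightarrow>\<^sub>0 complex)" where
  "walk_conv X v\<^sub>0 \<mu> \<nu> =
     (\<Sum>i\<in>{i \<in> dist_indices X. dist_rel X i \<in> Poly_Mapping.keys \<mu>}.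
      \<Sum>j\<in>{j \<in> dist_indices X. dist_rel X j \<in> Poly_Mapping.keys \<nu>}.
        cscale (Poly_Mapping.lookup \<mu> (dist_rel X i) * Poly_Mapping.lookup \<nu> (dist_rel X j))
          (walk_conv_basis X v\<^sub>0 i j))"


section \<open>Prism graphs\<close>

definition prism_group :: "nat \<Rightarrow> (int \<times> int) monoid" where
  "prism_group n = integer_mod_group n \<times>\<times> integer_mod_group 2"

definition prism :: "nat \<Rightarrow> (int \<times> int) sgraph" where
  "prism n =
     \<lparr> vertices = carrier (prism_group n),
       adj = {(v, w). v \<in> carrier (prism_group n) \<and> w \<in> carrier (prism_group n) \<and>
                v \<otimes>\<^bsub>prism_group n\<^esub> inv\<^bsub>prism_group n\<^esub> w
                  \<in> {(1 mod int n, 0), ((-1) mod int n, 0), (0, 1)}} \<rparr>"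

end

theory Submission
  imports Defs
begin

text \<open>
  For a function \<open>F\<close> of the distance, let \<open>T i F\<close> be the function
  \<open>j \<mapsto> \<Sum>k. P i j k * F k\<close>. As the prism is a Cayley graph of an abelian group, the coefficients are
  symmetric in \<open>i\<close> and \<open>j\<close> and independent of the base point, and then associativity says exactly
  that the operators \<open>T i\<close> commute. Averaging over spheres gives a closed formula for
  \<open>B i j = T i F j\<close>, from which one reads off the discrete wave equation: applying \<open>T 1\<close> in the
  variable \<open>i\<close> or in the variable \<open>j\<close> gives the same result. Since \<open>T 1\<close> is tridiagonal with
  nonzero upper entries, the wave equation makes \<open>T (i + 1)\<close> a combination of \<open>T 1 \<circ> T i\<close>, \<open>T i\<close> and
  \<open>T (i - 1)\<close>; so every \<open>T i\<close> is a polynomial in \<open>T 1\<close>, and they commute.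
\<close>

subsection \<open>Cyclic distance\<close>

text \<open>The distance from \<open>x\<close> to the nearest multiple of \<open>n\<close>, that is,
  the length of \<open>x\<close> around the cycle. It lives on all integers, so that radii add and
  subtract without reduction modulo \<open>n\<close>.\<close>

definition cyclic_dist :: "int \<Rightarrow> int \<Rightarrow> int" where
  "cyclic_dist n x = min (x mod n) ((- x) mod n)"

lemma cyclic_dist_low: "0 \<le> x \<Longrightarrow> 2 * x \<le> n \<Longrightarrow> cyclic_dist n x = x"
  by (cases "x = 0"; simp add: cyclic_dist_def zmod_zminus1_eq_if)

lemma cyclic_dist_minus: "cyclic_dist n (- x) = cyclic_dist n x"
  by (simp add: cyclic_dist_def min.commute)

lemma cyclic_dist_swap: "cyclic_dist n (x - y) = cyclic_dist n (y - x)"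
  by (metis cyclic_dist_minus minus_diff_eq)

lemma cyclic_dist_add_period: "cyclic_dist n (x + n) = cyclic_dist n x"
  using minus_mod_self2[of "- x" n] by (simp add: cyclic_dist_def)

lemma cyclic_dist_high: "x \<le> n \<Longrightarrow> n \<le> 2 * x \<Longrightarrow> cyclic_dist n x = n - x"
  using cyclic_dist_low[of "n - x" n] cyclic_dist_minus[of n "n-x"]
      cyclic_dist_add_period[of n "x-n"] by simp

lemma cyclic_dist_neg: "x \<le> 0 \<Longrightarrow> - n \<le> 2 * x \<Longrightarrow> cyclic_dist n x = - x"
  using cyclic_dist_low[of "- x" n] cyclic_dist_minus[of n x] by simp

lemma cyclic_dist_bounds:
  assumes "0 < n" shows "0 \<le> cyclic_dist n x" "2 * cyclic_dist n x \<le> n"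
proof -
  show "0 \<le> cyclic_dist n x" using assms by (simp add: cyclic_dist_def)
  have "(x mod n) + (- x) mod n \<le> n"
    using assms by (cases "x mod n = 0") (simp_all add: zmod_zminus1_eq_if)
  then show "2 * cyclic_dist n x \<le> n" unfolding cyclic_dist_def by linarith
qed

lemma cyclic_dist_cong: "x mod n = y mod n \<Longrightarrow> cyclic_dist n x = cyclic_dist n y"
  by (simp add: cyclic_dist_def mod_minus_cong[of x n y])

lemma cyclic_dist_mod [simp]: "cyclic_dist n (x mod n + y) = cyclic_dist n (x + y)"
    "cyclic_dist n (y + x mod n) = cyclic_dist n (y + x)"
  "cyclic_dist n (x mod n - y) = cyclic_dist n (x - y)"
      "cyclic_dist n (y - x mod n) = cyclic_dist n (y - x)"
      "cyclic_dist n (x mod n) = cyclic_dist n x"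
  by (rule cyclic_dist_cong, simp add: mod_simps)+

lemma cyclic_dist_eq_0_iff:
  assumes "0 < n" shows "cyclic_dist n x = 0 \<longleftrightarrow> x mod n = 0"
proof -
  have "x mod n \<noteq> n" using pos_mod_bound[OF assms, of x] by linarith
  then show ?thesis using assms by (auto simp: cyclic_dist_def min_def zmod_zminus1_eq_if)
qed

lemma cyclic_dist_eq_iff:
  assumes "0 \<le> i" "2 * i \<le> n" "0 < n"
  shows "cyclic_dist n x = i \<longleftrightarrow> x mod n = i \<or> (- x) mod n = i"
proof
  assume "cyclic_dist n x = i" then show "x mod n = i \<or> (- x) mod n = i" by
    (auto simp: cyclic_dist_def min_def split: if_splits)
next
  assume "x mod n = i \<or> (- x) mod n = i"
  then have "cyclic_dist n (x mod n) = i \<or> cyclic_dist n ((- x) mod n) = i"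
      using cyclic_dist_low assms by metis
  then show "cyclic_dist n x = i" by (simp add: cyclic_dist_minus)
qed

text \<open>Up to sign, \<open>x\<close> is congruent to its cyclic distance \<open>i\<close>. A
  step therefore leads to \<open>i + 1\<close> or \<open>i - 1\<close> up to sign, and folding never
  increases the absolute value.\<close>

lemma cyclic_dist_step:
  assumes "0 < n" shows "cyclic_dist n (x + 1) \<le> cyclic_dist n x + 1"
    "cyclic_dist n (x - 1) \<le> cyclic_dist n x + 1"
proof -
  have *: "cyclic_dist n (x + 1) \<le> cyclic_dist n x + 1" for x
  proof -
    obtain i where i: "0 \<le> i" "2 * i \<le> n" "cyclic_dist n x = i" using cyclic_dist_bounds[OF assms]
        by blast
    have up: "cyclic_dist n y \<le> max y (- y)" for y
    proof -
      have "y mod n \<le> y" if "0 \<le> y" for y using that assms by (simp add: zmod_le_nonneg_dividend)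
      then show ?thesis by (cases "0 \<le> y") (fastforce simp: cyclic_dist_def min_le_iff_disj)+
    qed
    have "x mod n = i \<or> (- x) mod n = i" using i cyclic_dist_eq_iff assms by blast
    then show ?thesis
    proof
      assume "x mod n = i"
      then have "cyclic_dist n (x + 1) = cyclic_dist n (i + 1)" by (metis cyclic_dist_mod(1))
      then show ?thesis using up[of "i + 1"] i by simp
    next
      assume "(- x) mod n = i"
      then have "cyclic_dist n (- x - 1) = cyclic_dist n (i - 1)" by (metis cyclic_dist_mod(3))
      then have "cyclic_dist n (x + 1) = cyclic_dist n (i - 1)"
          using cyclic_dist_minus[of n "x + 1"] by simp
      then show ?thesis using up[of "i - 1"] i by simp
    qed
  qed
  show "cyclic_dist n (x + 1) \<le> cyclic_dist n x + 1" by (rule *)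
  show "cyclic_dist n (x - 1) \<le> cyclic_dist n x + 1"
      using *[of "- x"] cyclic_dist_minus[of n "x - 1"] cyclic_dist_minus[of n x] by simp
qed

text \<open>Provides the next vertex of a shortest path: \<open>x\<close> is congruent to
  \<open>i\<close> or \<open>- i\<close>, so one of the two directions leads towards 0.\<close>

lemma cyclic_dist_descent:
  assumes "0 < n" "cyclic_dist n x \<noteq> 0"
  shows "cyclic_dist n (x - 1) = cyclic_dist n x - 1 \<or> cyclic_dist n (x + 1) = cyclic_dist n x - 1"
proof -
  obtain i where i: "0 \<le> i" "2 * i \<le> n" "cyclic_dist n x = i"
      using cyclic_dist_bounds[OF assms(1)] by blast
  then have "x mod n = i \<or> (- x) mod n = i" using cyclic_dist_eq_iff assms by blast
  then show ?thesis
  proof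
    assume "x mod n = i"
    then have "cyclic_dist n (x - 1) = cyclic_dist n (i - 1)" by (metis cyclic_dist_mod(3))
    then show ?thesis using i assms(2) cyclic_dist_low[of "i - 1" n] by simp
  next
    assume "(- x) mod n = i"
    then have "cyclic_dist n (- x - 1) = cyclic_dist n (i - 1)" by (metis cyclic_dist_mod(3))
    then have "cyclic_dist n (x + 1) = cyclic_dist n (i - 1)"
        using cyclic_dist_minus[of n "x + 1"] by simp
    then show ?thesis using i assms(2) cyclic_dist_low[of "i - 1" n] by simp
  qed
qed

subsection \<open>The wave equation\<close>

text \<open>
  A sphere of radius \<open>i\<close> about \<open>(a, s)\<close> in the prism consists of the points \<open>(a \<plusminus> i, s)\<close> and
  \<open>(a \<plusminus> (i - 1), 1 - s)\<close>; \<open>level_share n i\<close> is the fraction on the level \<open>s\<close>. The number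
  \<open>sphere_mean n F i j\<close> is the mean of \<open>F\<close> over the distances reached by a jump of length \<open>i\<close>
  followed by one of length \<open>j\<close>, that is \<open>\<Sum>k. P i j k * F k\<close>. In both, the radii are integers and meaningful only for
  \<open>0 \<le> i\<close> and \<open>2 * i \<le> n + 2\<close>.
\<close>

definition level_share :: "int \<Rightarrow> int \<Rightarrow> real" where
  "level_share n i = (if i = 0 then 1 else if i = 1 then 2/3 else if 2 * i < n then 1/2
              else if 2 * i = n then 1/3 else 0)"

definition sphere_mean :: "int \<Rightarrow> (int \<Rightarrow> real) \<Rightarrow> int \<Rightarrow> int \<Rightarrow> real" where
  "sphere_mean n F i j =
     (level_share n i * level_share n j
        * (F (cyclic_dist n (i + j)) + F (cyclic_dist n (i - j)))
      + (1 - level_share n i) * (1 - level_share n j)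
        * (F (cyclic_dist n (i + j - 2)) + F (cyclic_dist n (i - j)))
      + level_share n i * (1 - level_share n j)
        * (F (cyclic_dist n (i + j - 1) + 1) + F (cyclic_dist n (i - j + 1) + 1))
      + (1 - level_share n i) * level_share n j
        * (F (cyclic_dist n (i + j - 1) + 1) + F (cyclic_dist n (i - j - 1) + 1))) / 2"

text \<open>Exchanging the radii swaps the two mixed terms, and the cyclic distance is even.\<close>

lemma sphere_mean_commute: "sphere_mean n F i j = sphere_mean n F j i"
  using cyclic_dist_swap[of n i j] cyclic_dist_swap[of n "i+1" j] cyclic_dist_swap[of n "i" "j+1"]
  by (simp add: sphere_mean_def algebra_simps)

section \<open>The operator of the first sphere\<close>

lemma sphere_mean_step_0: "3 \<le> n \<Longrightarrow> sphere_mean n F 1 0 = F 1"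
  by (simp add: sphere_mean_def level_share_def cyclic_dist_low cyclic_dist_neg)

lemma sphere_mean_step_1: "4 \<le> n \<Longrightarrow> sphere_mean n F 1 1 = F 0 / 3 + 2/3 * F 2"
  by (simp add: sphere_mean_def level_share_def cyclic_dist_low cyclic_dist_neg field_simps)

lemma sphere_mean_step_mid:
    "2 \<le> j \<Longrightarrow> 2 * j + 2 \<le> n \<Longrightarrow> sphere_mean n F 1 j = (F (j - 1) + F (j + 1)) / 2"
  by (simp add: sphere_mean_def level_share_def cyclic_dist_low cyclic_dist_neg field_simps)

text \<open>For \<open>n = 2 * j + 1\<close> the points \<open>j\<close> and \<open>- j\<close> of
  the cycle are adjacent. A step along this edge keeps the distance, which yields the diagonal term
  \<open>F j / 6\<close>.\<close>

lemma sphere_mean_step_odd: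
    "2 \<le> j \<Longrightarrow> n = 2 * j + 1 \<Longrightarrow> sphere_mean n F 1 j = F (j - 1) / 2 + F j / 6 + F (j + 1) / 3"
  by (simp add: sphere_mean_def level_share_def cyclic_dist_low cyclic_dist_neg cyclic_dist_high
    field_simps)

lemma sphere_mean_step_even:
    "2 \<le> j \<Longrightarrow> n = 2 * j \<Longrightarrow> sphere_mean n F 1 j = 2/3 * F (j - 1) + F (j + 1) / 3"
  by (simp add: sphere_mean_def level_share_def cyclic_dist_low cyclic_dist_neg cyclic_dist_high
    field_simps)

text \<open>The last sphere of an odd prism consists of two adjacent points, hence the diagonal
  term. That of an even prism is a single point, so there is none in the next lemma.\<close>

lemma sphere_mean_step_odd_last:
    "3 \<le> j \<Longrightarrow> n = 2 * j - 1 \<Longrightarrow> sphere_mean n F 1 j = 2/3 * F (j - 1) + F j / 3"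
  by (simp add: sphere_mean_def level_share_def cyclic_dist_low cyclic_dist_neg cyclic_dist_high
    field_simps)

lemma sphere_mean_step_even_last: "3 \<le> j \<Longrightarrow> n = 2 * j - 2 \<Longrightarrow> sphere_mean n F 1 j = F (j - 1)"
  by (hypsubst, simp add: sphere_mean_def level_share_def cyclic_dist_low cyclic_dist_neg
    cyclic_dist_high field_simps)

text \<open>For \<open>n = 3\<close> the radius 1 is at once the first and the middle one, and 2 is
  already the last, so the formulas above cover neither.\<close>

lemma sphere_mean_step_3: "sphere_mean 3 F 1 1 = F 0 / 3 + 2/9 * F 1 + 4/9 * F 2"
    "sphere_mean 3 F 1 2 = 2/3 * F 1 + F 2 / 3"
  by (simp_all add: sphere_mean_def level_share_def cyclic_dist_low cyclic_dist_neg
    cyclic_dist_high field_simps)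

text \<open>
  The neighbour \<open>j = 1\<close> and, for even \<open>n\<close>, \<open>j = n / 2\<close> have other level shares than
  \<open>1 / 2\<close>, but against an interior sphere the folding of the cycle makes up for this, so that the
  formula with all shares equal to \<open>1 / 2\<close> still holds.
\<close>

lemma sphere_mean_interior:
  assumes "2 \<le> i" "2 * i + 2 \<le> n" "1 \<le> j" "2 * j \<le> n"
  shows "sphere_mean n F i j
      = (F (cyclic_dist n (i+j)) + 2 * F (cyclic_dist n (i-j)) + F (cyclic_dist n (i+j-2))
      + 2 * F (cyclic_dist n (i+j-1) + 1)
    + F (cyclic_dist n (i-j+1) + 1) + F (cyclic_dist n (i-j-1) + 1)) / 8"
proof -
  consider "j = 1" | "2 \<le> j" "2 * j < n" | "2 \<le> j" "n = 2 * j" using assms by linarith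
  then show ?thesis
  proof cases
    case 1 then show ?thesis using assms
      by (simp add: sphere_mean_def level_share_def cyclic_dist_low cyclic_dist_neg
        cyclic_dist_high field_simps)
  next
    case 2 then show ?thesis using assms
      by (simp add: sphere_mean_def level_share_def field_simps)
  next
    case 3 then show ?thesis using assms
      by (simp add: sphere_mean_def level_share_def cyclic_dist_low cyclic_dist_neg
        cyclic_dist_high field_simps)
  qed
qed

section \<open>The wave equation, case by case\<close>

lemmas cyclic_dist_fold = cyclic_dist_low cyclic_dist_neg cyclic_dist_high field_simps

text \<open>In the notation of the overview, and by symmetry of \<open>sphere_mean\<close>, the two
  sides are \<open>T 1 (T i F) j\<close> and \<open>T 1 (T j F) i\<close>.\<close>

definition wave_eq :: "int \<Rightarrow> (int \<Rightarrow> real) \<Rightarrow> int \<Rightarrow> int \<Rightarrow> bool" where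
  "wave_eq n F i j \<longleftrightarrow>
     sphere_mean n (\<lambda>x. sphere_mean n F i x) 1 j
     = sphere_mean n (\<lambda>x. sphere_mean n F x j) 1 i"

lemma wave_eq_3: "wave_eq 3 F 1 2"
  unfolding wave_eq_def sphere_mean_step_3
    by (simp add: sphere_mean_def level_share_def cyclic_dist_fold)

text \<open>The formula of \<open>sphere_mean_interior\<close> has the d'Alembert form
  \<open>f (i + j) + g (i - j)\<close> with \<open>g\<close> even, so the half sums over the
  neighbours of \<open>i\<close> and over those of \<open>j\<close> agree.\<close>

lemma wave_eq_interior:
  assumes "2 \<le> i" "2 * i + 2 \<le> n" "2 \<le> j" "2 * j + 2 \<le> n"
  shows "wave_eq n F i j"
proof -
  have e: "cyclic_dist n (j - i) = cyclic_dist n (i - j)"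
      "cyclic_dist n (j - i + 1) = cyclic_dist n (i - j - 1)"
      "cyclic_dist n (j - i + 2) = cyclic_dist n (i - j - 2)"
    "cyclic_dist n (j - i - 1) = cyclic_dist n (i - j + 1)"
        "cyclic_dist n (j - i - 2) = cyclic_dist n (i - j + 2)"
    using cyclic_dist_swap[of n j i] cyclic_dist_swap[of n "j+1" i]
        cyclic_dist_swap[of n "j" "i+1"] cyclic_dist_swap[of n "j+2" i]
        cyclic_dist_swap[of n "j" "i+2"]
    by (simp_all add: algebra_simps)
  \<comment> \<open>A shifted radius may be \<open>1\<close> or \<open>n / 2\<close>, which the
    interior formula admits only in its second place. Symmetry moves it there.\<close>
  have c: "sphere_mean n F x j = sphere_mean n F j x" for x by (rule sphere_mean_commute)
  have g: "sphere_mean n F i (j - 1)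
      = (F (cyclic_dist n (i+j-1)) + 2 * F (cyclic_dist n (i-j+1)) + F (cyclic_dist n (i+j-3))
      + 2 * F (cyclic_dist n (i+j-2) + 1)
    + F (cyclic_dist n (i-j+2) + 1) + F (cyclic_dist n (i-j) + 1)) / 8"
   "sphere_mean n F i (j + 1)
       = (F (cyclic_dist n (i+j+1)) + 2 * F (cyclic_dist n (i-j-1)) + F (cyclic_dist n (i+j-1))
       + 2 * F (cyclic_dist n (i+j) + 1)
    + F (cyclic_dist n (i-j) + 1) + F (cyclic_dist n (i-j-2) + 1)) / 8"
   "sphere_mean n F j (i - 1)
       = (F (cyclic_dist n (i+j-1)) + 2 * F (cyclic_dist n (j-i+1)) + F (cyclic_dist n (i+j-3))
       + 2 * F (cyclic_dist n (i+j-2) + 1)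
    + F (cyclic_dist n (j-i+2) + 1) + F (cyclic_dist n (j-i) + 1)) / 8"
   "sphere_mean n F j (i + 1)
       = (F (cyclic_dist n (i+j+1)) + 2 * F (cyclic_dist n (j-i-1)) + F (cyclic_dist n (i+j-1))
       + 2 * F (cyclic_dist n (i+j) + 1)
    + F (cyclic_dist n (j-i) + 1) + F (cyclic_dist n (j-i-2) + 1)) / 8"
    using assms sphere_mean_interior[of i n "j-1" F] sphere_mean_interior[of i n "j+1" F]
        sphere_mean_interior[of j n "i-1" F] sphere_mean_interior[of j n "i+1" F] by
        (simp_all add: algebra_simps)
  show ?thesis using assms
    unfolding wave_eq_def c[of "i+1"] c[of "i-1"]
      by (simp add: sphere_mean_step_mid g c[of "i+1"] c[of "i-1"] e add_divide_distrib)
qed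

text \<open>In this and the following cases some radius lies at an end of the range. The operator of
  the first sphere is replaced by its explicit formula in both variables, and the remaining
  distances are folded into the first half of the cycle.\<close>

lemma wave_eq_1_mid:
  assumes "2 \<le> j" "2 * j + 2 \<le> n"
  shows "wave_eq n F 1 j"
proof -
  have c: "sphere_mean n F x j = sphere_mean n F j x" for x by (rule sphere_mean_commute)
  have d: "4 \<le> n" using assms by simp
  \<comment> \<open>For \<open>n = 2 * j + 2\<close> the neighbour \<open>j + 1\<close> is
    \<open>n / 2\<close>, whose level share is \<open>1/3\<close>.\<close>
  show ?thesis using assms d
    unfolding wave_eq_def c
      by (cases "n = 2 * j + 2"; simp add: sphere_mean_step_mid sphere_mean_step_1[OF d]; simp add:
      sphere_mean_def level_share_def cyclic_dist_fold)
qed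

lemma wave_eq_1_odd:
  assumes "2 \<le> j" "n = 2 * j + 1"
  shows "wave_eq n F 1 j"
proof -
  have d: "4 \<le> n" using assms by simp
  show ?thesis using assms(1) d
      unfolding wave_eq_def sphere_mean_step_odd[OF assms] sphere_mean_step_1[OF d]
    unfolding assms by (simp add: sphere_mean_def level_share_def cyclic_dist_fold)
qed

lemma wave_eq_1_even:
  assumes "2 \<le> j" "n = 2 * j"
  shows "wave_eq n F 1 j"
proof -
  have d: "4 \<le> n" using assms by simp
  show ?thesis using assms(1) d
      unfolding wave_eq_def sphere_mean_step_even[OF assms] sphere_mean_step_1[OF d]
    unfolding assms by (simp add: sphere_mean_def level_share_def cyclic_dist_fold)
qed

lemma wave_eq_1_odd_last:
  assumes "3 \<le> j" "n = 2 * j - 1"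
  shows "wave_eq n F 1 j"
proof -
  have d: "4 \<le> n" using assms by simp
  show ?thesis using assms(1) d
      unfolding wave_eq_def sphere_mean_step_odd_last[OF assms] sphere_mean_step_1[OF d]
    unfolding assms by (simp add: sphere_mean_def level_share_def cyclic_dist_fold)
qed

lemma wave_eq_1_even_last:
  assumes "3 \<le> j" "n = 2 * j - 2"
  shows "wave_eq n F 1 j"
proof -
  have d: "4 \<le> n" using assms by simp
  show ?thesis using assms(1) d
      unfolding wave_eq_def sphere_mean_step_even_last[OF assms] sphere_mean_step_1[OF d]
    unfolding assms by (simp add: sphere_mean_def level_share_def cyclic_dist_fold)
qed

lemma wave_eq_mid_odd:
  assumes "2 \<le> i" "i < j" "n = 2 * j + 1"
  shows "wave_eq n F i j"
proof -
  have d: "2 \<le> j" "2 * i + 2 \<le> n" using assms by simp_all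
  show ?thesis using assms(1,2)
      unfolding wave_eq_def sphere_mean_step_odd[OF d(1) assms(3)]
      sphere_mean_step_mid[OF assms(1) d(2)]
    unfolding assms by (simp add: sphere_mean_def level_share_def cyclic_dist_fold)
qed

lemma wave_eq_mid_even:
  assumes "2 \<le> i" "i < j" "n = 2 * j"
  shows "wave_eq n F i j"
proof -
  have d: "2 \<le> j" "2 * i + 2 \<le> n" using assms by simp_all
  show ?thesis using assms(1,2)
      unfolding wave_eq_def sphere_mean_step_even[OF d(1) assms(3)]
      sphere_mean_step_mid[OF assms(1) d(2)]
    \<comment> \<open>For \<open>j = i + 1\<close> the upper neighbour of the interior radius
      \<open>i\<close> is already \<open>n / 2\<close>, where the level share changes.\<close>
    unfolding assms by (cases "j = i + 1"; simp add: sphere_mean_def level_share_def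
      cyclic_dist_fold)
qed

lemma wave_eq_mid_odd_last:
  assumes "2 \<le> i" "i + 1 < j" "n = 2 * j - 1"
  shows "wave_eq n F i j"
proof -
  have d: "3 \<le> j" "2 * i + 2 \<le> n" using assms by simp_all
  show ?thesis using assms(1,2)
      unfolding wave_eq_def sphere_mean_step_odd_last[OF d(1) assms(3)]
      sphere_mean_step_mid[OF assms(1) d(2)]
    unfolding assms by (simp add: sphere_mean_def level_share_def cyclic_dist_fold)
qed

lemma wave_eq_mid_even_last:
  assumes "2 \<le> i" "i + 1 < j" "n = 2 * j - 2"
  shows "wave_eq n F i j"
proof -
  have d: "3 \<le> j" "2 * i + 2 \<le> n" using assms by simp_all
  show ?thesis using assms(1,2)
      unfolding wave_eq_def sphere_mean_step_even_last[OF d(1) assms(3)]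
      sphere_mean_step_mid[OF assms(1) d(2)]
    unfolding assms by (simp add: sphere_mean_def level_share_def cyclic_dist_fold)
qed

text \<open>The two outermost radii form a case of their own, here and in the next lemma: as
  \<open>2 * i + 2 > n\<close>, the formula for interior radii fails to apply at
  \<open>i\<close>.\<close>

lemma wave_eq_odd_last:
  assumes "2 \<le> i" "j = i + 1" "n = 2 * i + 1"
  shows "wave_eq n F i j"
proof -
  have d: "3 \<le> j" "n = 2 * j - 1" using assms by simp_all
  show ?thesis using assms(1,2) d(1)
      unfolding wave_eq_def sphere_mean_step_odd_last[OF d] sphere_mean_step_odd[OF assms(1,3)]
    unfolding assms by (simp add: sphere_mean_def level_share_def cyclic_dist_fold)
qed

lemma wave_eq_even_last:
  assumes "2 \<le> i" "j = i + 1" "n = 2 * i"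
  shows "wave_eq n F i j"
proof -
  have d: "3 \<le> j" "n = 2 * j - 2" using assms by simp_all
  show ?thesis using assms(1,2) d(1)
      unfolding wave_eq_def sphere_mean_step_even_last[OF d] sphere_mean_step_even[OF assms(1,3)]
    unfolding assms by (simp add: sphere_mean_def level_share_def cyclic_dist_fold)
qed

lemma wave_eq_commute: "wave_eq n F i j \<longleftrightarrow> wave_eq n F j i"
  unfolding wave_eq_def sphere_mean_commute[of n F _ i] sphere_mean_commute[of n F j]
    by (rule eq_commute)

lemma wave_eq:
  assumes "3 \<le> n" "1 \<le> i" "2 * i \<le> n + 2" "1 \<le> j" "2 * j \<le> n + 2"
  shows "wave_eq n F i j"
proof -
  \<comment> \<open>Exchanging the radii exchanges the two sides, and for \<open>i = j\<close> they
    coincide. Only \<open>i < j\<close> needs the distinction by the position of \<open>j\<close>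
    relative to \<open>n / 2\<close>.\<close>
  have less: "wave_eq n F i j" if "1 \<le> i" "i < j" "2 * j \<le> n + 2" for i j
  proof (cases "n = 3")
    case True
    then have "i = 1" "j = 2" using that by presburger+
    then show ?thesis using True wave_eq_3 by simp
  next
    case False
    have "2 * j + 2 \<le> n \<or> n = 2 * j + 1 \<or> n = 2 * j \<or> n = 2 * j - 1 \<or> n = 2 * j - 2"
      using that by linarith
    then consider "2 * j + 2 \<le> n" | "n = 2 * j + 1" | "n = 2 * j" | "n = 2 * j - 1" |
        "n = 2 * j - 2"
      by blast
    then show ?thesis
    proof cases
      case 1 then show ?thesis using that wave_eq_1_mid wave_eq_interior by (cases "i = 1") auto
    next
      case 2 then show ?thesis using that wave_eq_1_odd wave_eq_mid_odd by (cases "i = 1") auto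
    next
      case 3 then show ?thesis using that wave_eq_1_even wave_eq_mid_even by (cases "i = 1") auto
    next
      case 4 then show ?thesis using that False assms(1) wave_eq_1_odd_last[of j n F]
        wave_eq_mid_odd_last[of i j n F] wave_eq_odd_last[of i j n F]
        by (cases "i = 1"; cases "j = i + 1"; simp)
    next
      case 5 then show ?thesis using that False assms(1) wave_eq_1_even_last[of j n F]
        wave_eq_mid_even_last[of i j n F] wave_eq_even_last[of i j n F]
        by (cases "i = 1"; cases "j = i + 1"; simp)
    qed
  qed
  consider "i < j" | "j < i" | "i = j" by linarith
  then show ?thesis
  proof cases
    case 1 then show ?thesis using less assms by blast
  next
    case 2 then show ?thesis using less[of j i] assms wave_eq_commute[of n F i j] by blast
  next
    case 3 then show ?thesis by (simp add: wave_eq_def sphere_mean_commute[of n F _ j])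
  qed
qed

subsection \<open>Commuting sphere operators\<close>

text \<open>\<open>F\<close> is evaluated only at cyclic distances and at their successors, and
  these lie between 0 and \<open>n / 2 + 1\<close>.\<close>

lemma sphere_mean_cong:
  assumes "0 < n" "\<And>x. 0 \<le> x \<Longrightarrow> 2 * x \<le> n + 2 \<Longrightarrow> F x = G x"
  shows "sphere_mean n F i j = sphere_mean n G i j"
  using cyclic_dist_bounds[OF assms(1)] by (simp add: sphere_mean_def assms(2) add_increasing2)

lemma sphere_mean_linear:
  "sphere_mean n (\<lambda>x. a * F x + b * G x + c * H x) i j = a * sphere_mean n F i j
      + b * sphere_mean n G i j + c * sphere_mean n H i j"
proof -
  \<comment> \<open>Naming the weights keeps the products of level shares from being
    expanded.\<close>
  define p q r s where "p = level_share n i * level_share n j / 2"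
    and "q = (1 - level_share n i) * (1 - level_share n j) / 2"
    and "r = level_share n i * (1 - level_share n j) / 2"
      and "s = (1 - level_share n i) * level_share n j / 2"
  have *: "sphere_mean n F i j = p * (F (cyclic_dist n (i + j)) + F (cyclic_dist n (i - j)))
      + q * (F (cyclic_dist n (i + j - 2)) + F (cyclic_dist n (i - j)))
      + r * (F (cyclic_dist n (i + j - 1) + 1) + F (cyclic_dist n (i - j + 1) + 1))
      + s * (F (cyclic_dist n (i + j - 1) + 1) + F (cyclic_dist n (i - j - 1) + 1))" for F
    by (simp only: sphere_mean_def p_def q_def r_def s_def add_divide_distrib times_divide_eq_left)
  show ?thesis unfolding * by (simp add: algebra_simps)
qed

lemma level_share_last: "3 \<le> n \<Longrightarrow> n < 2 * j \<Longrightarrow> level_share n j = 0"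
  by (auto simp: level_share_def)

text \<open>A jump of length 0 changes nothing. On the last sphere \<open>cyclic_dist n j\<close>
  differs from \<open>j\<close>, but there the level share vanishes and the other level contributes
  the distance \<open>(j - 1) + 1\<close>.\<close>

lemma sphere_mean_zero:
  assumes "3 \<le> n" "0 \<le> j" "2 * j \<le> n + 2"
  shows "sphere_mean n F 0 j = F j"
proof -
  have c: "cyclic_dist n (1 - j) = cyclic_dist n (j - 1)"
      "cyclic_dist n (- 1 - j) = cyclic_dist n (j + 1)"
    using cyclic_dist_swap[of n 1 j] cyclic_dist_swap[of n "-1" j] by simp_all
  consider "j = 0" | "1 \<le> j" "2 * j \<le> n" | "1 \<le> j" "n < 2 * j" using assms by linarith
  then show ?thesis
  proof cases
    case 1 then show ?thesis using assms
      by (simp add: sphere_mean_def level_share_def cyclic_dist_low)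
  next
    case 2 then show ?thesis using assms
      by (simp add: sphere_mean_def cyclic_dist_minus c cyclic_dist_low level_share_def[of n 0]
      field_simps)
  next
    case 3 then show ?thesis using assms
      by (simp add: sphere_mean_def c cyclic_dist_low level_share_last level_share_def[of n 0])
  qed
qed

text \<open>The nonzero coefficient \<open>a\<close> is what later permits solving for the operator
  of the next radius. The last radius is excluded, because no step leads further out from
  there.\<close>

lemma sphere_mean_step_tridiagonal:
  assumes "3 \<le> n" "1 \<le> j" "2 * j \<le> n"
  obtains a b c where "a \<noteq> 0" "\<And>F. sphere_mean n F 1 j = a * F (j + 1) + b * F j + c * F (j - 1)"
proof -
  consider "n = 3" "j = 1" | "4 \<le> n" "j = 1" | "2 \<le> j" "2 * j + 2 \<le> n" | "2 \<le> j" "n = 2 * j + 1" |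
    "2 \<le> j" "n = 2 * j"
    using assms by linarith
  then show ?thesis
  proof cases
    case 1 then show ?thesis using that[of "4/9" "2/9" "1/3"] by (simp add: sphere_mean_step_3)
  next
    case 2 then show ?thesis using that[of "2/3" 0 "1/3"] by (simp add: sphere_mean_step_1)
  next
    case 3 then show ?thesis using that[of "1/2" 0 "1/2"]
      by (simp add: sphere_mean_step_mid add_divide_distrib)
  next
    case 4 then show ?thesis using that[of "1/3" "1/6" "1/2"] sphere_mean_step_odd[OF 4] by simp
  next
    case 5 then show ?thesis using that[of "1/3" 0 "2/3"] sphere_mean_step_even[OF 5] by simp
  qed
qed

text \<open>The tridiagonal formula is applied at \<open>i\<close> to
  \<open>\<lambda>x. sphere_mean n F x j\<close>. The wave equation turns its left side into the
  operator of the first sphere acting in \<open>j\<close>, and one solves for the term with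
  \<open>i + 1\<close>.\<close>

lemma sphere_mean_recurrence:
  assumes "3 \<le> n" "1 \<le> i" "2 * i \<le> n"
  obtains a b c where
    "\<And>F j. 0 \<le> j \<Longrightarrow> 2 * j \<le> n + 2 \<Longrightarrow>
      sphere_mean n F (i + 1) j = a * sphere_mean n (sphere_mean n F i) 1 j
        + b * sphere_mean n F i j + c * sphere_mean n F (i - 1) j"
proof -
  obtain a b c where a: "a \<noteq> 0" and abc:
      "\<And>F. sphere_mean n F 1 i = a * F (i + 1) + b * F i + c * F (i - 1)"
    using sphere_mean_step_tridiagonal[OF assms] by blast
  have "sphere_mean n (sphere_mean n F i) 1 j = a * sphere_mean n F (i + 1) j
      + b * sphere_mean n F i j + c * sphere_mean n F (i - 1) j"
    if j: "0 \<le> j" "2 * j \<le> n + 2" for F j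
  proof (cases "j = 0")
    case True
    \<comment> \<open>The wave equation is available for positive radii only. At
      \<open>j = 0\<close> the first sphere operator evaluates at 1, and a mean with one radius 0 is
      the value at the other radius.\<close>
    have "sphere_mean n (sphere_mean n F i) 1 0 = sphere_mean n F 1 i"
      using assms by (simp add: sphere_mean_step_0 sphere_mean_commute[of n F i])
    then show ?thesis unfolding True sphere_mean_commute[of n F _ 0] abc
      using assms by (simp add: sphere_mean_zero)
  next
    case False
    then have "sphere_mean n (sphere_mean n F i) 1 j = sphere_mean n (\<lambda>x. sphere_mean n F x j) 1 i"
      using wave_eq[of n i j F] assms j by (simp add: wave_eq_def)
    then show ?thesis unfolding abc .
  qed
  then show ?thesis using a
    by (intro that[of "1 / a" "- b / a" "- c / a"]) (simp add: field_simps)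
qed

text \<open>
  By the recurrence all operators are polynomials in that of the first sphere.
\<close>

lemma sphere_mean_generated:
  assumes n: "3 \<le> n" and i: "2 * int i \<le> n + 2"
    and comm1: "\<And>F j. 0 \<le> j \<Longrightarrow> 2 * j \<le> n + 2 \<Longrightarrow> sphere_mean n (sphere_mean n F k) 1 j
      = sphere_mean n (sphere_mean n F 1) k j"
    and j: "0 \<le> j" "2 * j \<le> n + 2"
  shows "sphere_mean n (sphere_mean n F k) (int i) j = sphere_mean n (sphere_mean n F (int i)) k j"
  using i j
proof (induction i arbitrary: F j rule: less_induct)
  case (less i)
  have pos: "0 < n" using n by simp
  consider "i = 0" | "i = 1" | l where "i = Suc (Suc l)"
    by (metis One_nat_def old.nat.exhaust)
  then show ?case
  proof cases
    case 1
    then show ?thesis using less.prems n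
      by (simp add: sphere_mean_zero) (rule sphere_mean_cong[OF pos], simp add: sphere_mean_zero)
  next
    case 2 then show ?thesis using comm1 less.prems by simp
  next
    case 3
    obtain a b c where abc: "\<And>F j. 0 \<le> j \<Longrightarrow> 2 * j \<le> n + 2 \<Longrightarrow>
      sphere_mean n F (int i) j = a * sphere_mean n (sphere_mean n F (int (Suc l))) 1 j
        + b * sphere_mean n F (int (Suc l)) j + c * sphere_mean n F (int l) j"
      using sphere_mean_recurrence[of n "int (Suc l)"] n less.prems 3 by (auto simp: algebra_simps)
    \<comment> \<open>The hypothesis is needed at every \<open>x\<close> in range, because the
      recurrence puts a further mean of radius 1 around it.\<close>
    have IH: "sphere_mean n (sphere_mean n G k) (int (Suc l)) x
        = sphere_mean n (sphere_mean n G (int (Suc l))) k x"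
      "sphere_mean n (sphere_mean n G k) (int l) x = sphere_mean n (sphere_mean n G (int l)) k x"
      if "0 \<le> x" "2 * x \<le> n + 2" for x G
      using less.IH[of "Suc l" x G] less.IH[of l x G] that less.prems 3 by auto
    have "sphere_mean n (sphere_mean n F k) (int i) j =
        a * sphere_mean n (sphere_mean n (sphere_mean n F k) (int (Suc l))) 1 j
        + b * sphere_mean n (sphere_mean n F (int (Suc l))) k j
          + c * sphere_mean n (sphere_mean n F (int l)) k j"
      unfolding abc[OF less.prems(2,3)] IH[OF less.prems(2,3)] ..
    also have "sphere_mean n (sphere_mean n (sphere_mean n F k) (int (Suc l))) 1 j
        = sphere_mean n (sphere_mean n (sphere_mean n F (int (Suc l))) k) 1 j"
      using IH by (intro sphere_mean_cong[OF pos]) auto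
    also have "\<dots> = sphere_mean n (sphere_mean n (sphere_mean n F (int (Suc l))) 1) k j"
      using comm1 less.prems by simp
    also have "a * \<dots> + b * sphere_mean n (sphere_mean n F (int (Suc l))) k j
        + c * sphere_mean n (sphere_mean n F (int l)) k j
      = sphere_mean n (sphere_mean n F (int i)) k j"
      \<comment> \<open>By linearity the recurrence is read backwards inside the outer mean of
        radius \<open>k\<close>.\<close>
      unfolding sphere_mean_linear[symmetric] by (rule sphere_mean_cong[OF pos]) (simp add: abc)
    finally show ?thesis .
  qed
qed

text \<open>\<open>sphere_mean_generated\<close> is used twice: first with radius 1 in place of
  \<open>k\<close>, where its commutation hypothesis is trivial, to see that every operator commutes
  with that of the first sphere; then with the given \<open>k\<close>.\<close>

lemma sphere_mean_operators_commute:
  assumes "3 \<le> n" "2 * int i \<le> n + 2" "2 * int k \<le> n + 2" "0 \<le> j" "2 * j \<le> n + 2"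
  shows "sphere_mean n (sphere_mean n F (int k)) (int i) j
      = sphere_mean n (sphere_mean n F (int i)) (int k) j"
proof (rule sphere_mean_generated[OF assms(1,2) _ assms(4,5)])
  fix G x assume x: "0 \<le> x" "2 * x \<le> n + 2"
  show "sphere_mean n (sphere_mean n G (int k)) 1 x = sphere_mean n (sphere_mean n G 1) (int k) x"
    using sphere_mean_generated[OF assms(1,3) _ x, of 1 G] by simp
qed

subsection \<open>Hypergroups from walk coefficients\<close>

lemma lookup_cscale [simp]: "Poly_Mapping.lookup (cscale c \<mu>) x = c * Poly_Mapping.lookup \<mu> x"
  by (simp add: cscale_def Poly_Mapping.map.rep_eq when_def)

lemma lookup_conj_star [simp]: "Poly_Mapping.lookup (conj_star \<mu>) x = cnj (Poly_Mapping.lookup \<mu> x)"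
  by (simp add: conj_star_def Poly_Mapping.map.rep_eq when_def)

lemma lookup_pt: "Poly_Mapping.lookup (pt x) y = (if x = y then 1 else 0)"
  by (simp add: pt_def lookup_single when_def)

lemma conj_star_pt [simp]: "conj_star (pt x) = pt x"
  by (rule poly_mapping_eqI) (simp add: lookup_pt)

lemma pt_eq_iff [simp]: "pt x = pt y \<longleftrightarrow> x = y"
  by (metis lookup_pt zero_neq_one)

lemma mem_free_space_iff: "\<mu> \<in> free_space K \<longleftrightarrow> (\<forall>x. x \<notin> K \<longrightarrow> Poly_Mapping.lookup \<mu> x = 0)"
  by (auto simp: free_space_def in_keys_iff)

lemma walk_conv_cong:
  assumes "\<And>i j k. \<lbrakk>i \<in> dist_indices X; j \<in> dist_indices X; k \<in> dist_indices X\<rbrakk> \<Longrightarrow>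
             walk_coeff X v i j k = walk_coeff X w i j k"
  shows "walk_conv X v \<mu> \<nu> = walk_conv X w \<mu> \<nu>"
  unfolding walk_conv_def walk_conv_basis_def
  by (intro sum.cong refl arg_cong2[of _ _ _ _ cscale]) (auto simp: assms)

lemma sum_rotate3:
  "(\<Sum>a\<in>A. \<Sum>b\<in>B. \<Sum>c\<in>C. f a b c) = (\<Sum>c\<in>C. \<Sum>a\<in>A. \<Sum>b\<in>B. f a b c)"
proof -
  have "(\<Sum>a\<in>A. \<Sum>b\<in>B. \<Sum>c\<in>C. f a b c) = (\<Sum>a\<in>A. \<Sum>c\<in>C. \<Sum>b\<in>B. f a b c)"
    by (rule sum.cong[OF refl]) (rule sum.swap)
  also have "\<dots> = (\<Sum>c\<in>C. \<Sum>a\<in>A. \<Sum>b\<in>B. f a b c)" by (rule sum.swap)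
  finally show ?thesis .
qed

lemma sum_rotate4:
  "(\<Sum>l\<in>D. \<Sum>k\<in>C. \<Sum>i\<in>A. \<Sum>j\<in>B. f l k i j) = (\<Sum>i\<in>A. \<Sum>j\<in>B. \<Sum>k\<in>C. \<Sum>l\<in>D. f l k i j)"
proof -
  have "(\<Sum>l\<in>D. \<Sum>k\<in>C. \<Sum>i\<in>A. \<Sum>j\<in>B. f l k i j) = (\<Sum>i\<in>A. \<Sum>l\<in>D. \<Sum>k\<in>C. \<Sum>j\<in>B. f l k i j)"
    by (rule sum_rotate3)
  also have "\<dots> = (\<Sum>i\<in>A. \<Sum>j\<in>B. \<Sum>l\<in>D. \<Sum>k\<in>C. f l k i j)"
    by (rule sum.cong[OF refl]) (rule sum_rotate3)
  also have "\<dots> = (\<Sum>i\<in>A. \<Sum>j\<in>B. \<Sum>k\<in>C. \<Sum>l\<in>D. f l k i j)"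
    by (rule sum.cong[OF refl], rule sum.cong[OF refl]) (rule sum.swap)
  finally show ?thesis .
qed

text \<open>Under these assumptions an element of the free space is determined by its finitely many
  coordinates \<open>cf\<close>, and identities for the convolution become identities between sums
  of walk coefficients.\<close>

locale distance_indexed =
  fixes X :: "'v sgraph" and v\<^sub>0 :: 'v
  assumes finite_indices: "finite (dist_indices X)"
    and inj_dist_rel: "inj_on (dist_rel X) (dist_indices X)"
begin

abbreviation I where "I \<equiv> dist_indices X"
abbreviation P where "P \<equiv> walk_coeff X v\<^sub>0"
abbreviation cf :: "(('v \<times> 'v) set \<Rightarrow>\<^sub>0 complex) \<Rightarrow> nat \<Rightarrow> complex" where
  "cf \<mu> i \<equiv> Poly_Mapping.lookup \<mu> (dist_rel X i)"

lemma dist_rel_eq_iff: "i \<in> I \<Longrightarrow> j \<in> I \<Longrightarrow> dist_rel X i = dist_rel X j \<longleftrightarrow> i = j"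
  using inj_dist_rel by (auto dest: inj_onD)

lemma cf_pt: "i \<in> I \<Longrightarrow> k \<in> I \<Longrightarrow> cf (pt (dist_rel X i)) k = (if i = k then 1 else 0)"
  by (simp add: lookup_pt dist_rel_eq_iff)

lemma cf_walk_conv_basis:
  assumes "k \<in> I"
  shows "cf (walk_conv_basis X v\<^sub>0 i j) k = complex_of_real (P i j k)"
proof -
  have "cf (walk_conv_basis X v\<^sub>0 i j) k
      = (\<Sum>l\<in>I. if P i j l \<noteq> 0 then if l = k then complex_of_real (P i j l) else 0 else 0)"
    unfolding walk_conv_basis_def lookup_sum lookup_cscale
    using assms finite_indices by (simp add: cf_pt sum.inter_filter) (rule sum.cong; simp)
  also have "\<dots> = (\<Sum>l\<in>I. if l = k then complex_of_real (P i j l) else 0)"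
    by (rule sum.cong) auto
  finally show ?thesis using assms finite_indices by simp
qed

lemma cf_walk_conv:
  assumes "k \<in> I"
  shows "cf (walk_conv X v\<^sub>0 \<mu> \<nu>) k = (\<Sum>i\<in>I. \<Sum>j\<in>I. cf \<mu> i * cf \<nu> j * complex_of_real (P i j k))"
proof -
  have "cf (walk_conv X v\<^sub>0 \<mu> \<nu>) k =
     (\<Sum>i\<in>{i \<in> I. dist_rel X i \<in> Poly_Mapping.keys \<mu>}.
      \<Sum>j\<in>{j \<in> I. dist_rel X j \<in> Poly_Mapping.keys \<nu>}. cf \<mu> i * cf \<nu> j * complex_of_real (P i j k))"
    unfolding walk_conv_def lookup_sum lookup_cscale cf_walk_conv_basis[OF assms] ..
  also have "\<dots> = (\<Sum>i\<in>{i \<in> I. dist_rel X i \<in> Poly_Mapping.keys \<mu>}.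
      \<Sum>j\<in>I. cf \<mu> i * cf \<nu> j * complex_of_real (P i j k))"
    by (intro sum.cong refl sum.mono_neutral_left finite_indices) (auto simp: in_keys_iff)
  also have "\<dots> = (\<Sum>i\<in>I. \<Sum>j\<in>I. cf \<mu> i * cf \<nu> j * complex_of_real (P i j k))"
    by (intro sum.mono_neutral_left finite_indices) (auto simp: in_keys_iff)
  finally show ?thesis .
qed

lemma walk_conv_in_free_space: "walk_conv X v\<^sub>0 \<mu> \<nu> \<in> free_space (dist_rels X)"
  by (auto simp: mem_free_space_iff walk_conv_def walk_conv_basis_def lookup_sum lookup_pt
    dist_rels_def
      intro!: sum.neutral)

lemma free_space_eqI:
  assumes "\<mu> \<in> free_space (dist_rels X)" "\<nu> \<in> free_space (dist_rels X)"
    and "\<And>k. k \<in> I \<Longrightarrow> cf \<mu> k = cf \<nu> k"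
  shows "\<mu> = \<nu>"
proof (rule poly_mapping_eqI)
  fix r show "Poly_Mapping.lookup \<mu> r = Poly_Mapping.lookup \<nu> r"
    using assms by (cases "r \<in> dist_rels X") (auto simp: mem_free_space_iff dist_rels_def)
qed

lemma free_space_closed:
  shows "\<mu> \<in> free_space K \<Longrightarrow> \<nu> \<in> free_space K \<Longrightarrow> \<mu> + \<nu> \<in> free_space K"
    and "\<mu> \<in> free_space K \<Longrightarrow> cscale c \<mu> \<in> free_space K"
    and "\<mu> \<in> free_space K \<Longrightarrow> conj_star \<mu> \<in> free_space K"
  by (simp_all add: mem_free_space_iff lookup_add)

lemma walk_conv_bilinear: "bilinear_on (dist_rels X) (walk_conv X v\<^sub>0)"
  unfolding bilinear_on_def
  by (intro conjI ballI allI walk_conv_in_free_space;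
      rule free_space_eqI;
      simp add: walk_conv_in_free_space free_space_closed cf_walk_conv lookup_add
        sum.distrib sum_distrib_left algebra_simps)

lemma cf_walk_conv_pt:
  assumes "i \<in> I" "j \<in> I" "k \<in> I"
  shows "cf (walk_conv X v\<^sub>0 (pt (dist_rel X i)) (pt (dist_rel X j))) k = complex_of_real (P i j k)"
proof -
  have "cf (walk_conv X v\<^sub>0 (pt (dist_rel X i)) (pt (dist_rel X j))) k
    = (\<Sum>a\<in>I. if a = i then \<Sum>b\<in>I. if b = j then complex_of_real (P a b k) else 0 else 0)"
    unfolding cf_walk_conv[OF assms(3)]
    by (intro sum.cong refl) (auto simp: cf_pt assms(1,2) intro!: sum.cong)
  then show ?thesis using assms finite_indices by simp
qed

lemma walk_coeff_nonneg: "P i j k \<ge> 0"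
  unfolding walk_coeff_def by (intro mult_nonneg_nonneg sum_nonneg) auto

text \<open>Both triple products are expanded into fourfold sums, and the intermediate index
  \<open>l\<close> is moved innermost, where the hypothesis on the structure constants
  applies.\<close>

lemma walk_conv_assoc:
  assumes "\<And>i j k q. \<lbrakk>i \<in> I; j \<in> I; k \<in> I; q \<in> I\<rbrakk> \<Longrightarrow>
      (\<Sum>l\<in>I. P i j l * P l k q) = (\<Sum>l\<in>I. P j k l * P i l q)"
  shows "walk_conv X v\<^sub>0 (walk_conv X v\<^sub>0 \<mu> \<nu>) \<rho> = walk_conv X v\<^sub>0 \<mu> (walk_conv X v\<^sub>0 \<nu> \<rho>)"
proof (rule free_space_eqI; (rule walk_conv_in_free_space)?)
  fix q assume q: "q \<in> I"
  have "cf (walk_conv X v\<^sub>0 (walk_conv X v\<^sub>0 \<mu> \<nu>) \<rho>) q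
      = (\<Sum>l\<in>I. \<Sum>k\<in>I. \<Sum>i\<in>I. \<Sum>j\<in>I. cf \<mu> i * cf \<nu> j * cf \<rho> k * of_real (P i j l * P l k q))"
    by (simp add: cf_walk_conv q sum_distrib_left sum_distrib_right mult_ac)
  also have "\<dots> = (\<Sum>i\<in>I. \<Sum>j\<in>I. \<Sum>k\<in>I. \<Sum>l\<in>I. cf \<mu> i * cf \<nu> j * cf \<rho> k * of_real (P i j l * P l k q))"
    by (rule sum_rotate4)
  also have "\<dots> = (\<Sum>i\<in>I. \<Sum>j\<in>I. \<Sum>k\<in>I. cf \<mu> i * cf \<nu> j * cf \<rho> k * of_real (\<Sum>l\<in>I. P i j l * P l k q))"
    by (simp add: sum_distrib_left)
  also have "\<dots> = (\<Sum>i\<in>I. \<Sum>j\<in>I. \<Sum>k\<in>I. cf \<mu> i * cf \<nu> j * cf \<rho> k * of_real (\<Sum>l\<in>I. P j k l * P i l q))"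
    by (intro sum.cong refl arg_cong2[of _ _ _ _ "(*)"] arg_cong[of _ _ of_real] assms q)
  also have "\<dots> = (\<Sum>i\<in>I. \<Sum>j\<in>I. \<Sum>k\<in>I. \<Sum>l\<in>I. cf \<mu> i * cf \<nu> j * cf \<rho> k * of_real (P j k l * P i l q))"
    by (simp add: sum_distrib_left)
  also have "\<dots> = (\<Sum>i\<in>I. \<Sum>l\<in>I. \<Sum>j\<in>I. \<Sum>k\<in>I. cf \<mu> i * cf \<nu> j * cf \<rho> k * of_real (P j k l * P i l q))"
    by (rule sum.cong[OF refl]) (rule sum_rotate3)
  also have "\<dots> = cf (walk_conv X v\<^sub>0 \<mu> (walk_conv X v\<^sub>0 \<nu> \<rho>)) q"
    by (simp add: cf_walk_conv q sum_distrib_left sum_distrib_right mult_ac)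
  finally show "cf (walk_conv X v\<^sub>0 (walk_conv X v\<^sub>0 \<mu> \<nu>) \<rho>) q
    = cf (walk_conv X v\<^sub>0 \<mu> (walk_conv X v\<^sub>0 \<nu> \<rho>)) q" .
qed

lemma walk_conv_commute:
  assumes "\<And>i j k. \<lbrakk>i \<in> I; j \<in> I; k \<in> I\<rbrakk> \<Longrightarrow> P i j k = P j i k"
  shows "walk_conv X v\<^sub>0 \<mu> \<nu> = walk_conv X v\<^sub>0 \<nu> \<mu>"
proof (rule free_space_eqI; (rule walk_conv_in_free_space)?)
  fix k assume k: "k \<in> I"
  show "cf (walk_conv X v\<^sub>0 \<mu> \<nu>) k = cf (walk_conv X v\<^sub>0 \<nu> \<mu>) k"
    unfolding cf_walk_conv[OF k]
    by (subst sum.swap) (simp add: assms k mult_ac cong: sum.cong)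
qed

text \<open>The structure constants are real, so conjugating coefficients respects products. The
  reversal of factors required of an involution comes later from commutativity.\<close>

lemma conj_star_walk_conv:
  "conj_star (walk_conv X v\<^sub>0 \<mu> \<nu>) = walk_conv X v\<^sub>0 (conj_star \<mu>) (conj_star \<nu>)"
  by (rule free_space_eqI)
    (auto simp: walk_conv_in_free_space free_space_closed cf_walk_conv)

text \<open>The axioms in terms of structure constants: \<open>total\<close> yields norm 1, the
  constants being nonnegative, and \<open>return\<close> is the support condition at the neutral
  element, since \<open>conj_star\<close> fixes the basis.\<close>

theorem hermitian_hypergroup_walk_conv:
  assumes zero: "0 \<in> I"
    and total: "\<And>i j. \<lbrakk>i \<in> I; j \<in> I\<rbrakk> \<Longrightarrow> (\<Sum>k\<in>I. P i j k) = 1"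
    and commute: "\<And>i j k. \<lbrakk>i \<in> I; j \<in> I; k \<in> I\<rbrakk> \<Longrightarrow> P i j k = P j i k"
    and unit: "\<And>j k. \<lbrakk>j \<in> I; k \<in> I\<rbrakk> \<Longrightarrow> P 0 j k = (if j = k then 1 else 0)"
    and return: "\<And>i j. \<lbrakk>i \<in> I; j \<in> I\<rbrakk> \<Longrightarrow> P i j 0 \<noteq> 0 \<longleftrightarrow> i = j"
    and assoc: "\<And>i j k q. \<lbrakk>i \<in> I; j \<in> I; k \<in> I; q \<in> I\<rbrakk> \<Longrightarrow>
      (\<Sum>l\<in>I. P i j l * P l k q) = (\<Sum>l\<in>I. P j k l * P i l q)"
  shows "hermitian_hypergroup (dist_rels X) (walk_conv X v\<^sub>0) conj_star"
    and "commutative_hypergroup (dist_rels X) (walk_conv X v\<^sub>0) conj_star"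
proof -
  note comm = walk_conv_commute[OF commute]
  have star: "star_algebra_on (dist_rels X) (walk_conv X v\<^sub>0) conj_star"
    unfolding star_algebra_on_def conjugate_linear_on_def
  proof (intro conjI ballI allI)
    show "walk_conv X v\<^sub>0 (walk_conv X v\<^sub>0 \<mu> \<nu>) \<rho> = walk_conv X v\<^sub>0 \<mu> (walk_conv X v\<^sub>0 \<nu> \<rho>)"
        for \<mu> \<nu> \<rho>
      by (rule walk_conv_assoc[OF assoc])
    show "conj_star (walk_conv X v\<^sub>0 \<mu> \<nu>) = walk_conv X v\<^sub>0 (conj_star \<nu>) (conj_star \<mu>)" for \<mu> \<nu>
      unfolding conj_star_walk_conv by (rule comm)
  qed (auto simp: walk_conv_bilinear free_space_closed lookup_add intro!: poly_mapping_eqI)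
  have norm: "norm1 (walk_conv X v\<^sub>0 (pt (dist_rel X i)) (pt (dist_rel X j))) = 1"
    if "i \<in> I" "j \<in> I" for i j
  proof -
    let ?c = "walk_conv X v\<^sub>0 (pt (dist_rel X i)) (pt (dist_rel X j))"
    have "norm1 ?c = (\<Sum>x\<in>dist_rels X. cmod (Poly_Mapping.lookup ?c x))"
      unfolding norm1_def using walk_conv_in_free_space finite_indices
      by (intro sum.mono_neutral_left) (auto simp: free_space_def dist_rels_def in_keys_iff)
    also have "\<dots> = (\<Sum>k\<in>I. cmod (cf ?c k))"
      unfolding dist_rels_def by (rule sum.reindex_cong[OF inj_dist_rel]) auto
    also have "\<dots> = (\<Sum>k\<in>I. P i j k)"
      using that walk_coeff_nonneg by (intro sum.cong refl) (simp add: cf_walk_conv_pt)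
    finally show ?thesis using total that by simp
  qed
  have neutral: "neutral_in (dist_rels X) (walk_conv X v\<^sub>0) (dist_rel X 0)"
    unfolding neutral_in_def
  proof (intro conjI ballI)
    fix \<mu> assume \<mu>: "\<mu> \<in> free_space (dist_rels X)"
    show *: "walk_conv X v\<^sub>0 (pt (dist_rel X 0)) \<mu> = \<mu>"
    proof (rule free_space_eqI[OF walk_conv_in_free_space \<mu>])
      fix k assume k: "k \<in> I"
      have "cf (walk_conv X v\<^sub>0 (pt (dist_rel X 0)) \<mu>) k
          = (\<Sum>i\<in>I. if i = 0 then \<Sum>j\<in>I. if j = k then cf \<mu> j else 0 else 0)"
        unfolding cf_walk_conv[OF k]
        by (intro sum.cong refl) (auto simp: cf_pt zero unit k intro!: sum.cong)
      then show "cf (walk_conv X v\<^sub>0 (pt (dist_rel X 0)) \<mu>) k = cf \<mu> k"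
        using k zero finite_indices by simp
    qed
    then show "walk_conv X v\<^sub>0 \<mu> (pt (dist_rel X 0)) = \<mu>" by (subst comm)
  qed (simp add: dist_rels_def zero)
  have hyp: "discrete_hypergroup (dist_rels X) (walk_conv X v\<^sub>0) conj_star"
    unfolding discrete_hypergroup_def
  proof (intro conjI star exI[of _ "dist_rel X 0"] neutral)
    show "conj_star ` pt ` dist_rels X = pt ` dist_rels X"
      by (simp add: image_image)
    show "\<forall>x\<in>dist_rels X. \<forall>y\<in>dist_rels X.
        dist_rel X 0 \<in> Poly_Mapping.keys (walk_conv X v\<^sub>0 (pt x) (pt y)) \<longleftrightarrow> pt y = conj_star (pt x)"
      using return by (auto simp: dist_rels_def in_keys_iff cf_walk_conv_pt zero dist_rel_eq_iff)
  qed (auto simp: dist_rels_def cf_walk_conv_pt walk_coeff_nonneg norm)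
  show "hermitian_hypergroup (dist_rels X) (walk_conv X v\<^sub>0) conj_star"
    by (simp add: hermitian_hypergroup_def hyp)
  show "commutative_hypergroup (dist_rels X) (walk_conv X v\<^sub>0) conj_star"
    using comm by (simp add: commutative_hypergroup_def hyp)
qed

end

subsection \<open>Distances and spheres in graphs\<close>

text \<open>A criterion to recognise the graph distance: repeated descent produces a walk of length
  \<open>D v w\<close>, and the Lipschitz condition along edges excludes shorter ones.\<close>

lemma gdist_eqI:
  fixes X :: "'v sgraph" and D :: "'v \<Rightarrow> 'v \<Rightarrow> nat"
  assumes zero: "\<And>v w. v \<in> vertices X \<Longrightarrow> w \<in> vertices X \<Longrightarrow> D v w = 0 \<longleftrightarrow> v = w"
    and lip: "\<And>u v w. (u, v) \<in> adj X \<Longrightarrow> w \<in> vertices X \<Longrightarrow> D u w \<le> Suc (D v w)"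
    and descent: "\<And>v w. v \<in> vertices X \<Longrightarrow> w \<in> vertices X \<Longrightarrow> D v w \<noteq> 0 \<Longrightarrow>
      \<exists>u\<in>vertices X. (v, u) \<in> adj X \<and> D v w = Suc (D u w)"
    and v: "v \<in> vertices X" and w: "w \<in> vertices X"
  shows "gdist X v w = D v w" "(v, w) \<in> (adj X)\<^sup>*"
proof -
  have walk: "(v, w) \<in> adj X ^^ D v w"
    using v
  proof (induction "D v w" arbitrary: v)
    case 0
    then have "v = w" using zero[OF _ w] by metis
    then show ?case using 0 by simp
  next
    case (Suc d)
    then obtain u where u: "u \<in> vertices X" "(v, u) \<in> adj X" "D v w = Suc (D u w)"
      using descent[OF _ w] by (metis nat.distinct(1))
    then have "(u, w) \<in> adj X ^^ D u w" using Suc by simp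
    then show ?case unfolding u(3) using u(2) by (rule_tac relpow_Suc_I2)
  qed
  have shortest: "D v w \<le> m" if "(v, w) \<in> adj X ^^ m" for m
    using that
  proof (induction m arbitrary: v)
    case 0 then show ?case using zero[OF w w] by simp
  next
    case (Suc m)
    then obtain u where "(v, u) \<in> adj X" "(u, w) \<in> adj X ^^ m" by (meson relpow_Suc_D2)
    then show ?case using Suc.IH[of u] lip[of v u w] w by simp
  qed
  show "gdist X v w = D v w" unfolding gdist_def
    using walk shortest by (rule Least_equality)
  show "(v, w) \<in> (adj X)\<^sup>*" using walk by (rule relpow_imp_rtrancl)
qed

text \<open>Grouping the end points by their distance from \<open>v\<^sub>0\<close> turns the sum
  against \<open>F\<close> into the mean of \<open>F\<close> over a random walk of two
  jumps.\<close>

lemma sum_walk_coeff: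
  assumes fin: "finite (vertices X)" "finite (dist_indices X)"
    and dist: "\<And>w. w \<in> vertices X \<Longrightarrow> gdist X v\<^sub>0 w \<in> dist_indices X"
  shows "(\<Sum>k\<in>dist_indices X. walk_coeff X v\<^sub>0 i j k * F k) =
    (\<Sum>v\<in>gsphere X i v\<^sub>0. (\<Sum>w\<in>gsphere X j v. F (gdist X v\<^sub>0 w)) / card (gsphere X j v))
      / card (gsphere X i v\<^sub>0)"
proof -
  have finS: "finite (gsphere X j v)" for j v
    using fin(1) by (simp add: gsphere_def)
  have *: "(\<Sum>k\<in>dist_indices X. real (card (gsphere X j v \<inter> gsphere X k v\<^sub>0)) * F k)
      = (\<Sum>w\<in>gsphere X j v. F (gdist X v\<^sub>0 w))" for v
  proof -
    have "(\<Sum>w\<in>gsphere X j v. F (gdist X v\<^sub>0 w))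
      = (\<Sum>k\<in>dist_indices X. \<Sum>w\<in>{w\<in>gsphere X j v. gdist X v\<^sub>0 w = k}. F (gdist X v\<^sub>0 w))"
      using dist by (intro sum.group[symmetric] finS fin) (auto simp: gsphere_def)
    also have "\<dots> = (\<Sum>k\<in>dist_indices X. real (card (gsphere X j v \<inter> gsphere X k v\<^sub>0)) * F k)"
    proof (rule sum.cong[OF refl])
      fix k
      have "{w\<in>gsphere X j v. gdist X v\<^sub>0 w = k} = gsphere X j v \<inter> gsphere X k v\<^sub>0"
        by (auto simp: gsphere_def)
      then show "(\<Sum>w\<in>{w\<in>gsphere X j v. gdist X v\<^sub>0 w = k}. F (gdist X v\<^sub>0 w))
          = real (card (gsphere X j v \<inter> gsphere X k v\<^sub>0)) * F k"
        by (simp add: gsphere_def)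
    qed
    finally show ?thesis ..
  qed
  show ?thesis
    unfolding walk_coeff_def *[symmetric]
    by (simp add: sum_distrib_left sum_distrib_right sum_divide_distrib mult_ac) (rule sum.swap)
qed

text \<open>The sphere of radius 0 is the base point alone. A jump from distance \<open>i\<close>
  can hit it only if its length is \<open>i\<close>, and then every starting point contributes a
  positive amount.\<close>

lemma walk_coeff_zero_right:
  assumes v: "v\<^sub>0 \<in> vertices X"
    and zero: "\<And>w. w \<in> vertices X \<Longrightarrow> gdist X v\<^sub>0 w = 0 \<longleftrightarrow> w = v\<^sub>0"
    and sym: "\<And>w. w \<in> vertices X \<Longrightarrow> gdist X w v\<^sub>0 = gdist X v\<^sub>0 w"
    and fin: "finite (vertices X)"
    and "gsphere X i v\<^sub>0 \<noteq> {}"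
  shows "walk_coeff X v\<^sub>0 i j 0 \<noteq> 0 \<longleftrightarrow> i = j"
proof -
  have S: "gsphere X 0 v\<^sub>0 = {v\<^sub>0}" using zero v by (auto simp: gsphere_def)
  have finS: "finite (gsphere X j v)" for j v
    using fin by (simp add: gsphere_def)
  have I: "gsphere X j v \<inter> gsphere X 0 v\<^sub>0 = (if i = j then {v\<^sub>0} else {})"
      if "v \<in> gsphere X i v\<^sub>0" for v
    using that v sym unfolding S by (auto simp: gsphere_def)
  have "(\<Sum>v\<in>gsphere X i v\<^sub>0. real (card (gsphere X j v \<inter> gsphere X 0 v\<^sub>0))
      / real (card (gsphere X j v)))
    = (\<Sum>v\<in>gsphere X i v\<^sub>0. if i = j then 1 / real (card (gsphere X j v)) else 0)"
    by (intro sum.cong refl) (simp add: I)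
  moreover have "(\<Sum>v\<in>gsphere X i v\<^sub>0. 1 / real (card (gsphere X i v))) > 0"
  proof (rule sum_pos[OF finS assms(5)])
    fix v assume "v \<in> gsphere X i v\<^sub>0"
    then have "v\<^sub>0 \<in> gsphere X i v" using v sym by (auto simp: gsphere_def)
    then show "0 < 1 / real (card (gsphere X i v))" using finS card_gt_0_iff by fastforce
  qed
  ultimately show ?thesis using finS assms(5) by (cases "i = j") (simp_all add: walk_coeff_def)
qed

subsection \<open>The prism graph\<close>

text \<open>The candidate for the graph distance, confirmed in \<open>gdist_prism\<close>.\<close>

definition prism_dist :: "nat \<Rightarrow> int \<times> int \<Rightarrow> int \<times> int \<Rightarrow> nat" where
  "prism_dist n v w = nat (cyclic_dist (int n) (fst v - fst w)) + (if snd v = snd w then 0 else 1)"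

lemma vertices_prism: "0 < n \<Longrightarrow> vertices (prism n) = {0..<int n} \<times> {0..<2}"
  by (simp add: prism_def prism_group_def carrier_integer_mod_group)

text \<open>Eliminates the group operations: the three admissible differences are exactly those of
  length 1.\<close>

lemma adj_prism:
  assumes "3 \<le> n"
  shows "adj (prism n) = {(v, w). v \<in> vertices (prism n) \<and> w \<in> vertices (prism n)
      \<and> prism_dist n v w = 1}"
proof -
  have "(v \<otimes>\<^bsub>prism_group n\<^esub> inv\<^bsub>prism_group n\<^esub> w \<in> {(1 mod int n, 0), ((-1) mod int n, 0), (0, 1)})
      \<longleftrightarrow> prism_dist n v w = 1" if vw: "v \<in> vertices (prism n)" "w \<in> vertices (prism n)" for v w
  proof -
    obtain a s b t where [simp]: "v = (a, s)" "w = (b, t)" by (cases v; cases w)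
    have r: "a \<in> {0..<int n}" "b \<in> {0..<int n}" "s = 0 \<or> s = 1" "t = 0 \<or> t = 1"
      using vw assms by (auto simp: vertices_prism)
    have "inv\<^bsub>prism_group n\<^esub> w = ((- b) mod int n, (- t) mod 2)"
      using r assms by (auto simp: prism_group_def carrier_integer_mod_group)
    then have m: "v \<otimes>\<^bsub>prism_group n\<^esub> inv\<^bsub>prism_group n\<^esub> w = ((a - b) mod int n, (s - t) mod 2)"
      by (simp add: prism_group_def mod_simps)
    have e: "cyclic_dist (int n) (a - b) = 1 \<longleftrightarrow> (a - b) mod int n = 1 \<or> (a - b) mod int n
        = (-1) mod int n"
    proof -
      have "(- (a - b)) mod int n = 1 \<longleftrightarrow> (a - b) mod int n = (-1) mod int n"
        using mod_minus_cong[of "- (a - b)" "int n" 1] mod_minus_cong[of "a - b" "int n" "-1"]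
            assms by auto
      then show ?thesis using cyclic_dist_eq_iff[of 1 "int n" "a - b"] assms by simp
    qed
    have nn: "0 \<le> cyclic_dist (int n) (a - b)" using assms cyclic_dist_bounds by simp
    have z: "cyclic_dist (int n) (a - b) = 0 \<longleftrightarrow> (a - b) mod int n = 0" using assms
        by (intro cyclic_dist_eq_0_iff) simp
    have st: "(s - t) mod 2 = (if s = t then 0 else 1)" using r by auto
    have "nat (cyclic_dist (int n) (a - b)) = 1 \<longleftrightarrow> cyclic_dist (int n) (a - b) = 1"
        "nat (cyclic_dist (int n) (a - b)) = 0 \<longleftrightarrow> cyclic_dist (int n) (a - b) = 0"
      using nn by auto
    then show ?thesis unfolding m st prism_dist_def using e z assms by auto
  qed
  then show ?thesis by (auto simp: prism_def)
qed

context
  fixes n :: nat assumes n: "3 \<le> n"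
begin

lemma prism_dist_eq_0:
  assumes vw: "v \<in> vertices (prism n)" "w \<in> vertices (prism n)"
  shows "prism_dist n v w = 0 \<longleftrightarrow> v = w"
proof -
  obtain a s b t where [simp]: "v = (a, s)" "w = (b, t)" by (cases v; cases w)
  have nn: "0 \<le> cyclic_dist (int n) (a - b)" using n cyclic_dist_bounds by simp
  have z: "cyclic_dist (int n) (a - b) = 0 \<longleftrightarrow> a mod int n = b mod int n" using n
      by (subst cyclic_dist_eq_0_iff) (auto simp: mod_eq_dvd_iff dvd_eq_mod_eq_0)
  show ?thesis using nn z vw n by (auto simp: prism_dist_def vertices_prism)
qed

lemma prism_dist_commute: "prism_dist n v w = prism_dist n w v"
  using cyclic_dist_swap by (auto simp: prism_dist_def)

lemma prism_dist_lip:
  assumes "(u, v) \<in> adj (prism n)" "w \<in> vertices (prism n)"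
  shows "prism_dist n u w \<le> Suc (prism_dist n v w)"
proof -
  have n0: "0 < int n" using n by simp
  obtain a s b t c r where [simp]: "u = (a, s)" "v = (b, t)" "w = (c, r)"
      by (cases u; cases v; cases w)
  have uv: "u \<in> vertices (prism n)" "v \<in> vertices (prism n)" "prism_dist n u v = 1" using assms
      by (auto simp: adj_prism[OF n])
  show ?thesis
  proof (cases "s = t")
    case True
    then have "cyclic_dist (int n) (a - b) = 1" using uv(3) by (simp add: prism_dist_def)
    then have "(a - b) mod int n = 1 \<or> (- (a - b)) mod int n = 1"
        using cyclic_dist_eq_iff[of 1 "int n"] n by simp
    \<comment> \<open>In the second alternative all differences are reversed, so that both amount to
      a step \<open>+ 1\<close>.\<close>
    then have "cyclic_dist (int n) (a - c)
        = cyclic_dist (int n) (b - c + 1) \<or> cyclic_dist (int n) (c - a)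
        = cyclic_dist (int n) (c - b + 1)"
      using cyclic_dist_mod(1)[of "int n" "a - b" "b - c"]
          cyclic_dist_mod(1)[of "int n" "b - a" "c - b"] by (auto simp: algebra_simps)
    then have "cyclic_dist (int n) (a - c) \<le> cyclic_dist (int n) (b - c) + 1"
      using cyclic_dist_step[OF n0, of "b - c"] cyclic_dist_step[OF n0, of "c - b"]
          by (metis cyclic_dist_swap)
    then show ?thesis using True by (auto simp: prism_dist_def)
  next
    case False
    then have "cyclic_dist (int n) (a - b) \<le> 0" using uv(3) by (simp add: prism_dist_def)
    then have "cyclic_dist (int n) (a - b) = 0" using cyclic_dist_bounds(1)[OF n0]
        by (metis order_antisym)
    then have "(a - b) mod int n = 0" using cyclic_dist_eq_0_iff[OF n0] by simp
    then have "cyclic_dist (int n) (a - c) = cyclic_dist (int n) (b - c)"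
      using cyclic_dist_mod(1)[of "int n" "a - b" "b - c"] by simp
    then show ?thesis by (auto simp: prism_dist_def)
  qed
qed

text \<open>A shortest path first changes to the level of \<open>w\<close>, if necessary, and then
  goes round the cycle in a shorter direction.\<close>

lemma prism_dist_descent:
  assumes "v \<in> vertices (prism n)" "w \<in> vertices (prism n)" "prism_dist n v w \<noteq> 0"
  shows "\<exists>u\<in>vertices (prism n). (v, u) \<in> adj (prism n) \<and> prism_dist n v w = Suc (prism_dist n u w)"
proof -
  have n0: "0 < int n" using n by simp
  obtain a s b t where [simp]: "v = (a, s)" "w = (b, t)" by (cases v; cases w)
  have c1: "cyclic_dist (int n) 1 = 1" using n by (simp add: cyclic_dist_low)
  show ?thesis
  proof (cases "s = t")
    case False
    then show ?thesis using assms n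
      by (intro bexI[of _ "(a, t)"])
        (auto simp: adj_prism prism_dist_def vertices_prism cyclic_dist_low)
  next
    case True
    then have "cyclic_dist (int n) (a - b) \<noteq> 0" using assms by (auto simp: prism_dist_def)
    then have "cyclic_dist (int n) (a - b - 1)
        = cyclic_dist (int n) (a - b) - 1 \<or> cyclic_dist (int n) (a - b + 1)
        = cyclic_dist (int n) (a - b) - 1"
      by (rule cyclic_dist_descent[OF n0])
    then obtain e where e: "e = 1 \<or> e = -1"
        "cyclic_dist (int n) (a - b + e) = cyclic_dist (int n) (a - b) - 1"
      by (metis add_uminus_conv_diff)
    have "cyclic_dist (int n) ((a + e) mod int n - b) = cyclic_dist (int n) (a - b) - 1"
        using e(2) by (simp add: algebra_simps)
    moreover have "cyclic_dist (int n) (a - (a + e) mod int n) = 1"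
      using e(1) c1 cyclic_dist_minus[of "int n" 1] by auto
    moreover have "0 \<le> cyclic_dist (int n) ((a + e) mod int n - b)" using cyclic_dist_bounds n0
      by simp
    ultimately show ?thesis using assms True n
      by (intro bexI[of _ "((a + e) mod int n, t)"])
        (auto simp: adj_prism prism_dist_def vertices_prism)
  qed
qed

lemma gdist_prism:
    "v \<in> vertices (prism n) \<Longrightarrow> w \<in> vertices (prism n) \<Longrightarrow>
      gdist (prism n) v w = prism_dist n v w"
  and reachable_prism:
    "v \<in> vertices (prism n) \<Longrightarrow> w \<in> vertices (prism n) \<Longrightarrow> (v, w) \<in> (adj (prism n))\<^sup>*"
  using gdist_eqI[of "prism n" "prism_dist n"] prism_dist_eq_0 prism_dist_lip prism_dist_descent
      by blast+

lemma finite_vertices_prism: "finite (vertices (prism n))"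
  using n by (simp add: vertices_prism)

lemma prism_dist_le: "prism_dist n v w \<le> n div 2 + 1"
  using cyclic_dist_bounds(2)[of "int n" "fst v - fst w"] n by (auto simp: prism_dist_def)

lemma dist_indices_prism: "dist_indices (prism n) = {..n div 2 + 1}"
proof -
  have "gdiam (prism n) = enat (n div 2 + 1)"
  proof (rule antisym)
    show "gdiam (prism n) \<le> enat (n div 2 + 1)"
      unfolding gdiam_def by (intro SUP_least) (use prism_dist_le gdist_prism in auto)
    \<comment> \<open>The diameter is attained at a point farthest round the cycle and on the other
      level.\<close>
    have v: "(0, 0) \<in> vertices (prism n)" "(int (n div 2), 1) \<in> vertices (prism n)"
      using n by (auto simp: vertices_prism)
    have "gdist (prism n) (0, 0) (int (n div 2), 1) = n div 2 + 1"
      unfolding gdist_prism[OF v] using n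
        by (simp add: prism_dist_def cyclic_dist_minus cyclic_dist_low)
    then have "enat (n div 2 + 1) \<le> (SUP w\<in>vertices (prism n). enat (gdist (prism n) (0, 0) w))"
      by (metis SUP_upper v(2))
    also have "\<dots> \<le> gdiam (prism n)" unfolding gdiam_def by (rule SUP_upper[OF v(1)])
    finally show "enat (n div 2 + 1) \<le> gdiam (prism n)" .
  qed
  then show ?thesis by (auto simp: dist_indices_def)
qed

end

text \<open>The number of points of the cycle at distance \<open>i\<close>. Negative arguments
  matter: the sphere of radius 0 in the prism refers to \<open>i - 1\<close>.\<close>

definition cycle_sphere_size :: "int \<Rightarrow> int \<Rightarrow> real" where
  "cycle_sphere_size n i =
     (if i < 0 then 0 else if i = 0 then 1 else if 2 * i < n then 2
      else if 2 * i = n then 1 else 0)"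

text \<open>Giving each of \<open>a + i\<close> and \<open>a - i\<close> half the size of the sphere
  also covers \<open>i = 0\<close> and \<open>2 * i = n\<close>, where these points coincide and the
  size is 1.\<close>

lemma sum_cycle_sphere:
  fixes h :: "int \<Rightarrow> real"
  assumes n: "3 \<le> n"
  shows "(\<Sum>x\<in>{x\<in>{0..<n}. cyclic_dist n (a - x) = i}. h x)
      = cycle_sphere_size n i / 2 * (h ((a + i) mod n) + h ((a - i) mod n))"
proof (cases "0 \<le> i \<and> 2 * i \<le> n")
  case False
  then have "{x\<in>{0..<n}. cyclic_dist n (a - x) = i} = {}"
    using cyclic_dist_bounds[of n] n by auto
  note * = this
  show ?thesis unfolding * using False n by (auto simp: cycle_sphere_size_def)
next
  case True
  have n0: "0 < n" using n by simp
  have eq: "x = (b + c) mod n \<longleftrightarrow> (x - b) mod n = c mod n" if "x \<in> {0..<n}" for x b c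
  proof -
    have "x = (b + c) mod n \<longleftrightarrow> x mod n = (b + c) mod n" using that by simp
    also have "\<dots> \<longleftrightarrow> (x - b) mod n = c mod n" by (simp add: mod_eq_dvd_iff algebra_simps)
    finally show ?thesis .
  qed
  have "i < n" using True n by linarith
  then have i: "i mod n = i" using True by simp
  have set: "{x\<in>{0..<n}. cyclic_dist n (a - x) = i} = {(a + i) mod n, (a - i) mod n}" (is "?L = ?R")
  proof -
    have "x \<in> ?L \<longleftrightarrow> x \<in> ?R" for x
    proof (cases "x \<in> {0..<n}")
      case False then show ?thesis using n0 by auto
    next
      case x: True
      have "(- (a - x)) mod n = i \<longleftrightarrow> x = (a + i) mod n" using eq[OF x, of a i] i by simp
      moreover have "(a - x) mod n = i \<longleftrightarrow> x = (a - i) mod n"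
        using eq[OF x, of a "- i"] mod_minus_cong[of "a - x" n i]
            mod_minus_cong[of "x - a" n "-i"] i by auto
      ultimately show ?thesis using x cyclic_dist_eq_iff[of i n "a - x"] True n0 by auto
    qed
    then show ?thesis by blast
  qed
  have "(a + i) mod n = (a - i) mod n \<longleftrightarrow> n dvd 2 * i" by (simp add: mod_eq_dvd_iff)
  also have "\<dots> \<longleftrightarrow> i = 0 \<or> 2 * i = n"
    using True n zdvd_imp_le[of n "2 * i"] by (cases "i = 0") auto
  finally show ?thesis unfolding set using True by (auto simp: cycle_sphere_size_def)
qed

section \<open>Averages over spheres of the prism\<close>

context
  fixes n :: nat assumes n: "3 \<le> n"
begin

lemma int_order_pos: "0 < int n" "3 \<le> int n" using n by simp_all

text \<open>A change of level uses up one unit of the radius. For \<open>i = 0\<close> the integer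
  radius \<open>int i - 1\<close> is negative and the second part is empty.\<close>

lemma sum_gsphere_prism:
  fixes H :: "int \<times> int \<Rightarrow> real"
  assumes v: "(a, s) \<in> vertices (prism n)"
  shows "(\<Sum>w\<in>gsphere (prism n) i (a, s). H w) =
    cycle_sphere_size (int n)
      (int i) / 2 * (H ((a + int i) mod int n, s) + H ((a - int i) mod int n, s))
    + cycle_sphere_size (int n)
      (int i - 1) / 2 * (H ((a + (int i - 1)) mod int n, 1 - s)
      + H ((a - (int i - 1)) mod int n, 1 - s))"
proof -
  have s: "s = 0 \<or> s = 1" using v n by (auto simp: vertices_prism)
  let ?A = "\<lambda>i. {x\<in>{0..<int n}. cyclic_dist (int n) (a - x) = i}"
  have nn: "0 \<le> cyclic_dist (int n) x" for x using cyclic_dist_bounds int_order_pos by simp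
  have "gsphere (prism n) i (a, s)
      = (\<lambda>x. (x, s)) ` ?A (int i) \<union> (\<lambda>x. (x, 1 - s)) ` ?A (int i - 1)" (is "?L = ?R")
  proof -
    have "w \<in> ?L \<longleftrightarrow> w \<in> ?R" for w
    proof (cases "w \<in> vertices (prism n)")
      case False then show ?thesis using n s by (auto simp: gsphere_def vertices_prism)
    next
      case True
      obtain b t where w: "w = (b, t)" by (cases w)
      have t: "b \<in> {0..<int n}" "t = s \<or> t = 1 - s" using True n s by (auto simp: w vertices_prism)
      have "w \<in> ?L \<longleftrightarrow> prism_dist n (a, s) (b, t) = i"
        using True gdist_prism[OF n v True] by (simp add: gsphere_def w)
      also have "\<dots> \<longleftrightarrow> w \<in> ?R" using t nn[of "a - b"] s by (auto simp: w prism_dist_def)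
      finally show ?thesis .
    qed
    then show ?thesis by blast
  qed
  moreover have "sum H ((\<lambda>x. (x, s)) ` ?A (int i) \<union> (\<lambda>x. (x, 1 - s)) ` ?A (int i - 1))
    = (\<Sum>x\<in>?A (int i). H (x, s)) + (\<Sum>x\<in>?A (int i - 1). H (x, 1 - s))"
  proof -
    have fin: "finite (?A k)" for k by (rule finite_subset[of _ "{0..<int n}"]) auto
    show ?thesis
      using s by (subst sum.union_disjoint, intro finite_imageI fin, intro finite_imageI fin)
        (auto simp: sum.reindex inj_on_def)
  qed
  ultimately show ?thesis by (simp only: sum_cycle_sphere[OF int_order_pos(2)])
qed

lemma card_gsphere_prism:
  assumes "v \<in> vertices (prism n)"
  shows "real (card (gsphere (prism n) i v)) = cycle_sphere_size (int n) (int i)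
      + cycle_sphere_size (int n) (int i - 1)"
  using sum_gsphere_prism[of "fst v" "snd v" "\<lambda>_. 1" i] assms by simp

text \<open>Justifies the table in \<open>level_share\<close> by counting: the fractions are
  \<open>2/(2+1)\<close> at radius 1, \<open>2/(2+2)\<close> between and \<open>1/(1+2)\<close> at
  \<open>n / 2\<close>.\<close>

lemma level_share_eq_sphere_fraction:
  assumes "i \<le> n div 2 + 1"
  shows "cycle_sphere_size (int n) (int i) + cycle_sphere_size (int n) (int i - 1) > 0"
    and "level_share (int n) (int i)
      = cycle_sphere_size (int n)
      (int i) / (cycle_sphere_size (int n) (int i) + cycle_sphere_size (int n) (int i - 1))"
    and "1 - level_share (int n) (int i)
      = cycle_sphere_size (int n)
      (int i - 1) / (cycle_sphere_size (int n) (int i) + cycle_sphere_size (int n) (int i - 1))"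
proof -
  have "2 * i \<le> n + 2" using assms by linarith
  then have i: "2 * int i \<le> (int n) + 2" by linarith
  have "i = 0 \<or> i = 1 \<or> 2 \<le> i \<and> 2 * i < n \<or> 2 \<le> i \<and> 2 * i = n \<or> 2 \<le> i \<and> 2 * i = n + 1 \<or> 2 \<le> i
      \<and> 2 * i = n + 2"
    using \<open>2 * i \<le> n + 2\<close> by linarith
  then have "0 < cycle_sphere_size (int n) (int i) + cycle_sphere_size (int n) (int i - 1) \<and>
    level_share (int n) (int i)
      = cycle_sphere_size (int n)
      (int i) / (cycle_sphere_size (int n) (int i) + cycle_sphere_size (int n) (int i - 1))"
    using n by (elim disjE) (auto simp: cycle_sphere_size_def level_share_def)
  then show *: "0 < cycle_sphere_size (int n) (int i) + cycle_sphere_size (int n) (int i - 1)"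
    "level_share (int n) (int i)
        = cycle_sphere_size (int n)
        (int i) / (cycle_sphere_size (int n) (int i)
        + cycle_sphere_size (int n) (int i - 1))" by blast+
  show "1 - level_share (int n) (int i)
      = cycle_sphere_size (int n)
      (int i - 1) / (cycle_sphere_size (int n) (int i) + cycle_sphere_size (int n) (int i - 1))"
    using * by (simp add: field_simps)
qed

text \<open>A uniform point of the sphere arises by choosing the level according to
  \<open>level_share\<close> and then one of the two directions with probability
  \<open>1/2\<close>.\<close>

lemma average_gsphere_prism:
  fixes H :: "int \<times> int \<Rightarrow> real"
  assumes v: "(a, s) \<in> vertices (prism n)" and i: "i \<le> n div 2 + 1"
  shows "(\<Sum>w\<in>gsphere (prism n) i (a, s). H w) / real (card (gsphere (prism n) i (a, s))) =
    level_share (int n) (int i) *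
      ((H ((a + int i) mod int n, s) + H ((a - int i) mod int n, s)) / 2)
    + (1 - level_share (int n) (int i)) *
      ((H ((a + (int i - 1)) mod int n, 1 - s) + H ((a - (int i - 1)) mod int n, 1 - s)) / 2)"
proof -
  have *: "(p / 2 * x + q / 2 * y) / w = p / w * (x / 2) + q / w * (y / 2)" for p q w x y :: real
    by (cases "w = 0") (simp_all add: field_simps)
  show ?thesis
    unfolding card_gsphere_prism[OF v] sum_gsphere_prism[OF v]
      level_share_eq_sphere_fraction(3)[OF i]
    unfolding level_share_eq_sphere_fraction(2)[OF i] by (rule *)
qed

lemma mod_vertex: "(x mod int n, t) \<in> vertices (prism n) \<longleftrightarrow> t = 0 \<or> t = 1"
  using n by (auto simp: vertices_prism)

text \<open>The link between the random walk and \<open>sphere_mean\<close>: averaging is carried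
  out once for each jump, and translation invariance of the cyclic distance removes the base
  point.\<close>

lemma sum_walk_coeff_prism:
  assumes v: "v\<^sub>0 \<in> vertices (prism n)" and i: "i \<le> n div 2 + 1" and j: "j \<le> n div 2 + 1"
  shows "(\<Sum>k\<le>n div 2 + 1. walk_coeff (prism n) v\<^sub>0 i j k * F k)
      = sphere_mean (int n) (\<lambda>x. F (nat x)) (int i) (int j)"
proof -
  obtain a s where v0: "v\<^sub>0 = (a, s)" by (cases v\<^sub>0)
  have s: "s = 0 \<or> s = 1" using v n by (auto simp: v0 vertices_prism)
  have d: "gdist (prism n) (a, s) (x mod int n, t) = nat (cyclic_dist (int n) (x - a))
      + (if s = t then 0 else 1)" if "t = 0 \<or> t = 1" for x t
    using gdist_prism[OF n, of "(a, s)" "(x mod int n, t)"] v that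
        by (simp add: v0 mod_vertex prism_dist_def cyclic_dist_swap[of "int n" a x])
  have inner: "(\<Sum>w\<in>gsphere (prism n) j (x mod int n, t). F (gdist (prism n) (a, s) w)) / real
      (card (gsphere (prism n) j (x mod int n, t)))
    = level_share (int n) (int j) *
      (F (nat (cyclic_dist (int n) (x + int j - a)) + (if s = t then 0 else 1))
      + F (nat (cyclic_dist (int n) (x - int j - a)) + (if s = t then 0 else 1))) / 2
    + (1 - level_share (int n) (int j)) *
      (F (nat (cyclic_dist (int n) (x + (int j - 1) - a)) + (if s = t then 1 else 0))
      + F (nat (cyclic_dist (int n) (x - (int j - 1) - a)) + (if s = t then 1 else 0))) / 2"
    if "t = 0 \<or> t = 1" for x t
  proof -
    have t: "1 - t = 0 \<or> 1 - t = 1" "(if s = 1 - t then 0 else 1 :: nat) = (if s = t then 1 else 0)"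
      using that s by auto
    have "(x mod int n, t) \<in> vertices (prism n)" using that by (simp add: mod_vertex)
    note avg = average_gsphere_prism[OF this j, of "\<lambda>w. F (gdist (prism n) (a, s) w)"]
    show ?thesis
      unfolding avg mod_simps d[OF that] d[OF t(1)] t(2) by simp
  qed
  \<comment> \<open>The successor is taken among integers in \<open>sphere_mean\<close>, but among
    natural numbers in the graph distance.\<close>
  have nat1: "nat (cyclic_dist (int n) x + 1) = nat (cyclic_dist (int n) x) + 1" for x
    using cyclic_dist_bounds(1)[OF int_order_pos(1), of x] by simp
  let ?i = "int i" and ?j = "int j"
  have c: "cyclic_dist (int n) (a + ?i + ?j - a) = cyclic_dist (int n) (?i + ?j)"
    "cyclic_dist (int n) (a + ?i - ?j - a) = cyclic_dist (int n) (?i - ?j)"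
    "cyclic_dist (int n) (a + ?i + (?j - 1) - a) = cyclic_dist (int n) (?i + ?j - 1)"
    "cyclic_dist (int n) (a + ?i - (?j - 1) - a) = cyclic_dist (int n) (?i - ?j + 1)"
    "cyclic_dist (int n) (a + (?i - 1) + ?j - a) = cyclic_dist (int n) (?i + ?j - 1)"
    "cyclic_dist (int n) (a + (?i - 1) - ?j - a) = cyclic_dist (int n) (?i - ?j - 1)"
    "cyclic_dist (int n) (a + (?i - 1) + (?j - 1) - a) = cyclic_dist (int n) (?i + ?j - 2)"
    "cyclic_dist (int n) (a + (?i - 1) - (?j - 1) - a) = cyclic_dist (int n) (?i - ?j)"
    by (simp_all add: algebra_simps)
  \<comment> \<open>The first jump in the negative direction: by reflection it leads to the same
    distances, which is why \<open>sphere_mean\<close> lists one direction only.\<close>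
  have c': "cyclic_dist (int n) (a - ?i + ?j - a) = cyclic_dist (int n) (?i - ?j)"
    "cyclic_dist (int n) (a - ?i - ?j - a) = cyclic_dist (int n) (?i + ?j)"
    "cyclic_dist (int n) (a - ?i + (?j - 1) - a) = cyclic_dist (int n) (?i - ?j + 1)"
    "cyclic_dist (int n) (a - ?i - (?j - 1) - a) = cyclic_dist (int n) (?i + ?j - 1)"
    "cyclic_dist (int n) (a - (?i - 1) + ?j - a) = cyclic_dist (int n) (?i - ?j - 1)"
    "cyclic_dist (int n) (a - (?i - 1) - ?j - a) = cyclic_dist (int n) (?i + ?j - 1)"
    "cyclic_dist (int n) (a - (?i - 1) + (?j - 1) - a) = cyclic_dist (int n) (?i - ?j)"
    "cyclic_dist (int n) (a - (?i - 1) - (?j - 1) - a) = cyclic_dist (int n) (?i + ?j - 2)"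
    by (subst cyclic_dist_minus[symmetric], simp add: algebra_simps)+
  have s': "1 - s = 0 \<or> 1 - s = 1" "s \<noteq> 1 - s" using s by presburger+
  have "(\<Sum>k\<le>n div 2 + 1. walk_coeff (prism n) v\<^sub>0 i j k * F k) =
    (\<Sum>v\<in>gsphere (prism n) i (a, s). (\<Sum>w\<in>gsphere (prism n) j v. F (gdist (prism n) (a, s) w))
      / real (card (gsphere (prism n) j v))) / real (card (gsphere (prism n) i (a, s)))"
    using sum_walk_coeff[of "prism n" v\<^sub>0 i j F] finite_vertices_prism[OF n] gdist_prism[OF n v]
        prism_dist_le[OF n]
    by (simp add: dist_indices_prism[OF n] v0)
  also have "\<dots> = sphere_mean (int n) (\<lambda>x. F (nat x)) ?i ?j"
    unfolding average_gsphere_prism[OF v[unfolded v0] i] inner[OF s] inner[OF s'(1)]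
      sphere_mean_def c c' nat1
    using s' by (simp add: field_simps)
  finally show ?thesis .
qed

text \<open>The indicator function of \<open>k\<close> extracts a single coefficient. The base point
  has disappeared from the right side, which gives independence of its choice.\<close>

lemma prism_walk_coeff:
  assumes "v\<^sub>0 \<in> vertices (prism n)" "i \<le> n div 2 + 1" "j \<le> n div 2 + 1" "k \<le> n div 2 + 1"
  shows "walk_coeff (prism n) v\<^sub>0 i j k
      = sphere_mean (int n) (\<lambda>x. if nat x = k then 1 else 0) (int i) (int j)"
  using sum_walk_coeff_prism[OF assms(1-3), of "\<lambda>l. if l = k then 1 else 0"] assms(4)
  by (simp add: if_distrib cong: if_cong)

lemma radius_bound_iff: "i \<le> n div 2 + 1 \<longleftrightarrow> 2 * int i \<le> int n + 2" by linarith

text \<open>With the indicator function of \<open>q\<close> in place of \<open>F\<close>, both sides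
  become iterated means at \<open>j\<close>, and the claim is that the operators of radii
  \<open>i\<close> and \<open>k\<close> commute.\<close>

lemma walk_coeff_prism_assoc:
  assumes v: "v\<^sub>0 \<in> vertices (prism n)"
    and r: "i \<le> n div 2 + 1" "j \<le> n div 2 + 1" "k \<le> n div 2 + 1" "q \<le> n div 2 + 1"
  shows "(\<Sum>l\<le>n div 2 + 1. walk_coeff (prism n) v\<^sub>0 i j l * walk_coeff (prism n) v\<^sub>0 l k q)
    = (\<Sum>l\<le>n div 2 + 1. walk_coeff (prism n) v\<^sub>0 j k l * walk_coeff (prism n) v\<^sub>0 i l q)"
proof -
  let ?F = "\<lambda>x :: int. if nat x = q then 1 else 0 :: real"
  have inr: "nat x \<le> n div 2 + 1" if "0 \<le> x" "2 * x \<le> int n + 2" for x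
    using that by linarith
  have "(\<Sum>l\<le>n div 2 + 1. walk_coeff (prism n) v\<^sub>0 i j l * walk_coeff (prism n) v\<^sub>0 l k q)
    = sphere_mean (int n) (\<lambda>x. walk_coeff (prism n) v\<^sub>0 (nat x) k q) (int i) (int j)"
    by (rule sum_walk_coeff_prism[OF v r(1,2)])
  also have "\<dots> = sphere_mean (int n) (sphere_mean (int n) ?F (int k)) (int i) (int j)"
    using v r inr by (intro sphere_mean_cong int_order_pos)
        (simp add: prism_walk_coeff sphere_mean_commute[of "int n" _ _ "int k"])
  also have "\<dots> = sphere_mean (int n) (sphere_mean (int n) ?F (int i)) (int k) (int j)"
    using r n by (intro sphere_mean_operators_commute) (auto simp: radius_bound_iff)
  also have "\<dots> = sphere_mean (int n) (sphere_mean (int n) ?F (int i)) (int j) (int k)"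
    by (rule sphere_mean_commute)
  also have "\<dots> = sphere_mean (int n) (\<lambda>x. walk_coeff (prism n) v\<^sub>0 i (nat x) q) (int j) (int k)"
    using v r inr by (intro sphere_mean_cong int_order_pos) (simp add: prism_walk_coeff)
  also have "\<dots> = (\<Sum>l\<le>n div 2 + 1. walk_coeff (prism n) v\<^sub>0 j k l * walk_coeff (prism n) v\<^sub>0 i l q)"
    by (rule sum_walk_coeff_prism[OF v r(2,3), symmetric])
  finally show ?thesis .
qed

section \<open>Hypergroup axioms for the prism\<close>

lemma card_gsphere_prism_nonzero:
  assumes "v \<in> vertices (prism n)" "i \<le> n div 2 + 1"
  shows "card (gsphere (prism n) i v) \<noteq> 0"
  using card_gsphere_prism[OF assms(1), of i] level_share_eq_sphere_fraction(1)[OF assms(2)]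
      by linarith

lemma walk_coeff_defined_prism: "v\<^sub>0 \<in> vertices (prism n) \<Longrightarrow> walk_coeff_defined (prism n) v\<^sub>0"
  using card_gsphere_prism_nonzero
  by (auto simp: walk_coeff_defined_def dist_indices_prism[OF n] gsphere_def simp del:
    card_eq_0_iff card_0_eq)

text \<open>Every sphere about \<open>(0, 0)\<close> is nonempty, and any pair in a relation
  determines its distance.\<close>

lemma inj_dist_rel_prism: "inj_on (dist_rel (prism n)) {..n div 2 + 1}"
proof (rule inj_onI)
  fix i j assume i: "i \<in> {..n div 2 + 1}" and eq: "dist_rel (prism n) i = dist_rel (prism n) j"
  have v: "(0, 0) \<in> vertices (prism n)" using n by (simp add: vertices_prism)
  then have "gsphere (prism n) i (0, 0) \<noteq> {}"
    using card_gsphere_prism_nonzero[OF v, of i] i by auto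
  then obtain w where "w \<in> gsphere (prism n) i (0, 0)" by blast
  then have "((0, 0), w) \<in> dist_rel (prism n) i" "w \<in> gsphere (prism n) i (0, 0)" using v
      by (auto simp: dist_rel_def gsphere_def)
  then show "i = j" unfolding eq by (auto simp: dist_rel_def gsphere_def)
qed

theorem prism_hypergroup:
  assumes v: "v\<^sub>0 \<in> vertices (prism n)"
  shows "hermitian_hypergroup (dist_rels (prism n)) (walk_conv (prism n) v\<^sub>0) conj_star"
    and "commutative_hypergroup (dist_rels (prism n)) (walk_conv (prism n) v\<^sub>0) conj_star"
proof -
  note I = dist_indices_prism[OF n]
  interpret distance_indexed "prism n" v\<^sub>0
    by unfold_locales (simp_all add: I inj_dist_rel_prism del: One_nat_def)
  have facts: "0 \<in> dist_indices (prism n)"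
    "\<And>i j. \<lbrakk>i \<in> dist_indices (prism n); j \<in> dist_indices (prism n)\<rbrakk> \<Longrightarrow>
       (\<Sum>k\<in>dist_indices (prism n). walk_coeff (prism n) v\<^sub>0 i j k) = 1"
    "\<And>i j k. \<lbrakk>i \<in> dist_indices (prism n); j \<in> dist_indices (prism n); k \<in> dist_indices (prism n)\<rbrakk> \<Longrightarrow>
       walk_coeff (prism n) v\<^sub>0 i j k = walk_coeff (prism n) v\<^sub>0 j i k"
    "\<And>j k. \<lbrakk>j \<in> dist_indices (prism n); k \<in> dist_indices (prism n)\<rbrakk> \<Longrightarrow>
       walk_coeff (prism n) v\<^sub>0 0 j k = (if j = k then 1 else 0)"
    "\<And>i j. \<lbrakk>i \<in> dist_indices (prism n); j \<in> dist_indices (prism n)\<rbrakk> \<Longrightarrow>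
       walk_coeff (prism n) v\<^sub>0 i j 0 \<noteq> 0 \<longleftrightarrow> i = j"
    "\<And>i j k q. \<lbrakk>i \<in> dist_indices (prism n); j \<in> dist_indices (prism n); k \<in> dist_indices
        (prism n); q \<in> dist_indices (prism n)\<rbrakk> \<Longrightarrow>
      (\<Sum>l\<in>dist_indices (prism n). walk_coeff (prism n) v\<^sub>0 i j l * walk_coeff (prism n) v\<^sub>0 l k q)
        = (\<Sum>l\<in>dist_indices (prism n). walk_coeff (prism n) v\<^sub>0 j k l * walk_coeff (prism n) v\<^sub>0 i
          l q)"
    unfolding I atMost_iff
  proof -
    fix i j k q assume i: "i \<le> n div 2 + 1" and j: "j \<le> n div 2 + 1"
    show "(\<Sum>k\<le>n div 2 + 1. walk_coeff (prism n) v\<^sub>0 i j k) = 1"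
      \<comment> \<open>For the constant function 1 the mean is the sum of its weights.\<close>
      using sum_walk_coeff_prism[OF v i j, of "\<lambda>_. 1"] by (simp add: sphere_mean_def algebra_simps)
    have "gsphere (prism n) i v\<^sub>0 \<noteq> {}" using card_gsphere_prism_nonzero[OF v i] by auto
    then show "walk_coeff (prism n) v\<^sub>0 i j 0 \<noteq> 0 \<longleftrightarrow> i = j"
      using v prism_dist_eq_0[OF n] finite_vertices_prism[OF n] prism_dist_commute[OF n]
      by (intro walk_coeff_zero_right) (auto simp: gdist_prism[OF n])
    assume k: "k \<le> n div 2 + 1"
    show "walk_coeff (prism n) v\<^sub>0 i j k = walk_coeff (prism n) v\<^sub>0 j i k"
      using v i j k sphere_mean_commute by (simp add: prism_walk_coeff)
    show "walk_coeff (prism n) v\<^sub>0 0 j k = (if j = k then 1 else 0)"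
      using v j k n by (simp add: prism_walk_coeff sphere_mean_zero radius_bound_iff)
  qed (use walk_coeff_prism_assoc[OF v] in auto)
  show "hermitian_hypergroup (dist_rels (prism n)) (walk_conv (prism n) v\<^sub>0) conj_star"
    by (rule hermitian_hypergroup_walk_conv[OF facts])
  show "commutative_hypergroup (dist_rels (prism n)) (walk_conv (prism n) v\<^sub>0) conj_star"
    by (rule hermitian_hypergroup_walk_conv[OF facts])
qed

lemma walk_conv_prism_base_independent:
  assumes "v \<in> vertices (prism n)" "w \<in> vertices (prism n)"
  shows "walk_conv (prism n) v \<mu> \<nu> = walk_conv (prism n) w \<mu> \<nu>"
  using assms by (intro walk_conv_cong)
      (auto simp: dist_indices_prism[OF n] prism_walk_coeff simp del: One_nat_def)

section \<open>Graph properties of the prism and the order of its hypergroup\<close>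

lemma simple_graph_prism: "simple_graph (prism n)"
  unfolding simple_graph_def adj_prism[OF n]
  using prism_dist_commute[OF n]
      by (auto simp: sym_def irrefl_def prism_dist_eq_0[OF n] prism_dist_def cyclic_dist_low)

lemma connected_graph_prism: "connected_graph (prism n)"
  using n reachable_prism[OF n] by (auto simp: connected_graph_def vertices_prism)

lemma locally_finite_graph_prism: "locally_finite_graph (prism n)"
proof -
  have "{w. (v, w) \<in> adj (prism n)} \<subseteq> vertices (prism n)" for v by (auto simp: adj_prism[OF n])
  then show ?thesis using finite_vertices_prism[OF n]
      by (auto simp: locally_finite_graph_def intro: finite_subset)
qed

lemma finite_dist_rels_prism: "finite (dist_rels (prism n))"
  by (simp add: dist_rels_def dist_indices_prism[OF n])

lemma card_dist_rels_prism: "card (dist_rels (prism n)) = n div 2 + 2"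
  using card_image[OF inj_dist_rel_prism] by (simp add: dist_rels_def dist_indices_prism[OF n])

end

theorem mainTheorem4:
  shows "(\<forall>n\<ge>3.
            simple_graph (prism n) \<and> connected_graph (prism n) \<and> locally_finite_graph (prism n) \<and>
            finite (dist_rels (prism n)) \<and>
            (\<forall>v\<^sub>0\<in>vertices (prism n).
               walk_coeff_defined (prism n) v\<^sub>0 \<and>
               hermitian_hypergroup (dist_rels (prism n)) (walk_conv (prism n) v\<^sub>0) conj_star \<and>
               commutative_hypergroup (dist_rels (prism n)) (walk_conv (prism n) v\<^sub>0) conj_star) \<and>
            (\<forall>v\<^sub>0\<in>vertices (prism n). \<forall>v\<^sub>1\<in>vertices (prism n).
               \<forall>\<mu>\<in>free_space (dist_rels (prism n)). \<forall>\<nu>\<in>free_space (dist_rels (prism n)).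
                 walk_conv (prism n) v\<^sub>0 \<mu> \<nu> = walk_conv (prism n) v\<^sub>1 \<mu> \<nu>)) \<and>
         (\<forall>N::nat. \<exists>n\<ge>3. \<exists>v\<^sub>0\<in>vertices (prism n).
            finite (dist_rels (prism n)) \<and> card (dist_rels (prism n)) \<ge> N \<and>
            commutative_hypergroup (dist_rels (prism n)) (walk_conv (prism n) v\<^sub>0) conj_star)"
proof (intro conjI allI impI ballI)
  fix N :: nat
  \<comment> \<open>For \<open>n = 2 * N + 3\<close> the order is
    \<open>n div 2 + 2 = N + 3\<close>.\<close>
  have "(0, 0) \<in> vertices (prism (2 * N + 3))" by (simp add: vertices_prism)
  moreover have "N \<le> card (dist_rels (prism (2 * N + 3)))" by (subst card_dist_rels_prism) simp_all
  ultimately show "\<exists>n\<ge>3. \<exists>v\<^sub>0\<in>vertices (prism n).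
            finite (dist_rels (prism n)) \<and> card (dist_rels (prism n)) \<ge> N \<and>
            commutative_hypergroup (dist_rels (prism n)) (walk_conv (prism n) v\<^sub>0) conj_star"
    by (intro exI[of _ "2 * N + 3"] conjI bexI[of _ "(0, 0)"] finite_dist_rels_prism prism_hypergroup) simp_all
qed (use simple_graph_prism connected_graph_prism locally_finite_graph_prism finite_dist_rels_prism
    walk_coeff_defined_prism prism_hypergroup walk_conv_prism_base_independent in blast)+

end
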